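(* The function $$F(x,t)=\sum_{m\ge0,\ k>1}\frac{f_m(FM(k))}{k!}\,t^mx^k,$$ the generating series counting the cells of the Fulton–MacPherson spaces $FM(k)$, is an algebraic expression that can be computed explicitly.
   Context: $f_m(FM(k))$ is the number of $m$-dimensional cells of the CW decomposition of the Fulton–MacPherson space $FM(k)$ (the Axelrod–Singer/Fulton–MacPherson compactification of the configuration space of $k$ points in $\mathbb{C}$ modulo translations and positive dilations), whose cells are indexed as follows. (The decomposition depends on a choice of positive weights $a_1,\dots,a_k$, but the indexing of the cells does not.) A cell is determined by a nested tree $\mathcal{S}$ on $k$ leaves; for each vertex $v$ of $\mathcal{S}$, a nested tree $\mathcal{S}_v$ on $|v|$ leaves (corresponding to the edges entering $v$); and for each vertex $u$ of $\mathcal{S}_v$, a cell $\sigma_u$ of the cacti complex $\mathcal{C}_{|u|}$. Its dimension is $\sum_{v\in\mathcal{S}}\big(|\mathcal{S}_v|-1+\sum_{u\in\mathcal{S}_v}\dim\sigma_u\big)$. The group $\Sigma_k$ acts freely on the set of cells for $k>1$, so the coefficients of $F$ are integers. A nested tree on $k$ leaves is a collection $\mathcal{S}$ of subsets of $\{1,\dots,k\}$ of cardinality $\ge2$ (the vertices), containing $\{1,\dots,k\}$, any two of which are disjoint or nested. The edges entering a vertex $S$ are the maximal vertices strictly contained in $S$, together with the leaves $i$ for which $S$ is the smallest vertex containing $i$. For a vertex $v$, $|v|$ is the number of edges entering it; $|\mathcal{S}|$ is the number of vertices of $\mathcal{S}$. The $m$-cells of the cacti complex $\mathcal{C}_k$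 are indexed by surjections $f:\{1,\dots,m+k\}\to\{1,\dots,k\}$ such that $f(a)\ne f(a+1)$ for all $a$ and there are no $a<b<c<d$ with $f(a)=f(c)\ne f(b)=f(d)$. *)

theory Defs
  imports "HOL-Library.FuncSet" "HOL-Computational_Algebra.Computational_Algebra"
begin

definition nested_tree :: "'a set \<Rightarrow> 'a set set \<Rightarrow> bool" where
  "nested_tree L S \<longleftrightarrow>
     L \<in> S \<and> (\<forall>V\<in>S. V \<subseteq> L \<and> card V \<ge> 2) \<and>
     (\<forall>V\<in>S. \<forall>W\<in>S. V \<inter> W = {} \<or> V \<subseteq> W \<or> W \<subseteq> V)"

text \<open>An edge entering \<open>V\<close> is encoded as a subset of \<open>V\<close>: a leaf \<open>i\<close> becomes the singleton \<open>{i}\<close>,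
  which cannot be confused with a vertex since vertices have at least two elements.\<close>

definition entering_edges :: "'a set set \<Rightarrow> 'a set \<Rightarrow> 'a set set" where
  "entering_edges S V =
     {W \<in> S. W \<subset> V \<and> \<not> (\<exists>W'\<in>S. W \<subset> W' \<and> W' \<subset> V)} \<union>
     {{i} | i. i \<in> V \<and> (\<forall>W\<in>S. i \<in> W \<longrightarrow> V \<subseteq> W)}"

text \<open>A map \<open>f\<close> on \<open>{1..m+k}\<close> is encoded as the word \<open>[f 1, \<dots>, f (m+k)]\<close>; its dimension \<open>m\<close> is the
  length of the word minus the number \<open>k\<close> of its letters.\<close>

definition cacti_cells :: "nat \<Rightarrow> nat list set" where
  "cacti_cells k =
     {w. set w = {1..k} \<and>
         (\<forall>a. Suc a < length w \<longrightarrow> w ! a \<noteq> w ! Suc a) \<and>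
         \<not> (\<exists>a b c d. a < b \<and> b < c \<and> c < d \<and> d < length w \<and>
              w ! a = w ! c \<and> w ! b = w ! d \<and> w ! a \<noteq> w ! b)}"

definition cacti_dim :: "nat list \<Rightarrow> nat" where
  "cacti_dim w = length w - card (set w)"

text \<open>A cell of \<open>FM(k)\<close> is a triple \<open>(S, T, \<sigma>)\<close>, where \<open>T V\<close> is the nested tree attached to the vertex \<open>V\<close>
  of \<open>S\<close> (its leaves being the edges entering \<open>V\<close>) and \<open>\<sigma> V U\<close> is the cacti cell attached to the
  vertex \<open>U\<close> of \<open>T V\<close>. Extensionality makes distinct triples correspond to distinct cells.\<close>

type_synonym FM_cell =
  "nat set set \<times> (nat set \<Rightarrow> nat set set set) \<times> (nat set \<Rightarrow> nat set set \<Rightarrow> nat list)"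

definition FM_cells :: "nat \<Rightarrow> FM_cell set" where
  "FM_cells k =
     {(S, T, \<sigma>). nested_tree {1..k} S \<and>
        T \<in> (\<Pi>\<^sub>E V\<in>S. {N. nested_tree (entering_edges S V) N}) \<and>
        \<sigma> \<in> (\<Pi>\<^sub>E V\<in>S. \<Pi>\<^sub>E U\<in>T V. cacti_cells (card (entering_edges (T V) U)))}"

fun FM_dim :: "FM_cell \<Rightarrow> nat" where
  "FM_dim (S, T, \<sigma>) = (\<Sum>V\<in>S. (card (T V) - 1) + (\<Sum>U\<in>T V. cacti_dim (\<sigma> V U)))"

definition FM_face_number :: "nat \<Rightarrow> nat \<Rightarrow> nat" where
  "FM_face_number k m = card {c \<in> FM_cells k. FM_dim c = m}"

text \<open>The ring \<open>\<rat>[[x, t]]\<close> is represented as \<open>\<rat>[[t]][[x]]\<close>.\<close>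

abbreviation ser_x :: "rat fps fps" where "ser_x \<equiv> fps_X"
abbreviation ser_t :: "rat fps fps" where "ser_t \<equiv> fps_const fps_X"

definition FM_series :: "rat fps fps" where
  "FM_series = Abs_fps (\<lambda>k. Abs_fps (\<lambda>m.
     if k > 1 then of_nat (FM_face_number k m) / fact k else 0))"

definition series_of_bipoly :: "rat poly poly \<Rightarrow> rat fps fps" where
  "series_of_bipoly p = fps_of_poly (map_poly fps_of_poly p)"

text \<open>Algebraicity over \<open>\<rat>(x, t)\<close>, with denominators cleared: the annihilating polynomial has
  coefficients in \<open>\<rat>[t][x]\<close>.\<close>

definition algebraic_series :: "rat fps fps \<Rightarrow> bool" where
  "algebraic_series G \<longleftrightarrow>
     (\<exists>P :: rat poly poly poly. P \<noteq> 0 \<and> poly (map_poly series_of_bipoly P) G = 0)"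

end

theory Submission
  imports Defs "HOL-Library.Sublist" "HOL-Library.Disjoint_Sets"
begin

text \<open>
  Let \<open>Z\<^sub>r\<close> be the power series solution of \<open>Z = x (1 + Z) + r Z\<^sup>2\<close>. Cutting a cactus word at the first
  return to its initial letter shows that \<open>Z\<^sub>t\<close> is the exponential generating series of cacti cells.
  If \<open>W\<close> is the exponential generating series of vertex weights, then weighted nested trees are
  counted by the series \<open>T\<close> with \<open>T = x + W(T)\<close>, by splitting a tree at its root. Both layers of trees
  stay inside the family: \<open>Z\<^sub>t\<close> composed with \<open>(x + t Z\<^sub>r) / (1 + t)\<close> is \<open>Z\<^sub>r\<close> for \<open>r = 2 t + t\<^sup>2\<close>,
  and this \<open>Z\<^sub>r\<close> composed with \<open>x + (Z\<^sub>q - x) / (2 + t)\<close> is \<open>Z\<^sub>q\<close> for \<open>q = 1 + 3 t + t\<^sup>2\<close>.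
  Hence \<open>F = (Z\<^sub>q - x) / (2 + t)\<close>, and the quadratic formula for \<open>Z\<^sub>q\<close> gives the theorem.
\<close>

section \<open>A family of quadratic series\<close>

text \<open>Splitting a label set in two multiplies exponential generating series: the number
  \<open>card A choose j\<close> of subsets of size \<open>j\<close> absorbs the two inner
  factorials into \<open>fact (card A)\<close>.\<close>

lemma sum_Pow_fact:
  fixes a b :: "nat \<Rightarrow> 'r::{comm_semiring_1,semiring_char_0}"
  assumes "finite A"
  shows "(\<Sum>U\<in>Pow A. (fact (card U) * a (card U)) * (fact (card A - card U) * b (card A - card U)))
    = fact (card A) * (\<Sum>j\<le>card A. a j * b (card A - j))"
proof -
  define h where "h j = (fact j * a j) * (fact (card A - j) * b (card A - j))" for j
  have "(\<Sum>U\<in>Pow A. h (card U)) = (\<Sum>j\<le>card A. \<Sum>U\<in>{U\<in>Pow A. card U = j}. h (card U))"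
    using assms by (intro sum.group [symmetric]) (auto intro: card_mono)
  also have "\<dots> = (\<Sum>j\<le>card A. of_nat (card A choose j) * h j)"
    using n_subsets [OF assms] by (intro sum.cong refl) (simp add: Pow_def)
  also have "\<dots> = (\<Sum>j\<le>card A. fact (card A) * (a j * b (card A - j)))"
  proof (intro sum.cong refl)
    fix j assume "j \<in> {..card A}"
    hence "fact j * fact (card A - j) * (card A choose j) = fact (card A)"
      by (intro binomial_fact_lemma) simp
    from arg_cong [OF this, of "of_nat :: nat \<Rightarrow> 'r"]
    have *: "(fact j * fact (card A - j) * of_nat (card A choose j) :: 'r) = fact (card A)"
      by simp
    show "of_nat (card A choose j) * h j = fact (card A) * (a j * b (card A - j))"
      unfolding h_def * [symmetric] by (simp add: mult_ac)
  qed
  finally show ?thesis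
    by (simp add: h_def sum_distrib_left)
qed

text \<open>Coefficientwise form of Z = x (1 + Z) + r Z^2. The case \<open>n = 0\<close> supplies
  the 1 in 1 + Z. The sum omits both end terms, which vanish with the constant coefficient, so that
  the recursion only calls smaller arguments.\<close>

fun quad_coeff :: "'r::comm_ring_1 \<Rightarrow> nat \<Rightarrow> 'r" where
  "quad_coeff r 0 = 0"
| "quad_coeff r (Suc n) = (if n = 0 then 1 else quad_coeff r n) +
     r * (\<Sum>j\<in>{1..n}. quad_coeff r j * quad_coeff r (Suc n - j))"

declare quad_coeff.simps(2) [simp del]

definition quad_series :: "'r::comm_ring_1 \<Rightarrow> 'r fps" where
  "quad_series r = Abs_fps (quad_coeff r)"

lemma quad_series_nth [simp]: "fps_nth (quad_series r) n = quad_coeff r n"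
  by (simp add: quad_series_def)

lemma quad_series_eq:
  "quad_series r = fps_X * (1 + quad_series r) + fps_const r * quad_series r ^ 2"
proof (rule fps_ext)
  fix n
  show "fps_nth (quad_series r) n =
    fps_nth (fps_X * (1 + quad_series r) + fps_const r * quad_series r ^ 2) n"
  proof (cases n)
    case 0
    then show ?thesis by (simp add: power2_eq_square)
  next
    case (Suc m)
    have "(\<Sum>i=0..Suc m. quad_coeff r i * quad_coeff r (Suc m - i))
      = (\<Sum>j\<in>{1..m}. quad_coeff r j * quad_coeff r (Suc m - j))"
      by (rule sum.mono_neutral_right) (auto simp: not_le less_Suc_eq_le le_Suc_eq)
    hence "fps_nth (quad_series r ^ 2) (Suc m) =
        (\<Sum>j\<in>{1..m}. quad_coeff r j * quad_coeff r (Suc m - j))"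
      by (simp only: power2_eq_square fps_mult_nth quad_series_nth)
    thus ?thesis using Suc by (simp add: quad_coeff.simps(2))
  qed
qed

text \<open>The difference of two solutions is killed by \<open>1 - T - c * (Y + Y')\<close>, which
  has constant term 1 and hence is nonzero in a domain.\<close>

lemma quadratic_unique:
  fixes Y Y' :: "'r::idom fps"
  assumes "Y = T * (1 + Y) + c * Y ^ 2" "Y' = T * (1 + Y') + c * Y' ^ 2"
    and "fps_nth Y 0 = 0" "fps_nth Y' 0 = 0" "fps_nth T 0 = 0"
  shows "Y = Y'"
proof -
  have "(Y - Y') * (1 - T - c * (Y + Y')) = (Y - (T * (1 + Y) + c * Y ^ 2)) - (Y' - (T * (1 + Y') + c * Y' ^ 2))"
    by (simp add: algebra_simps power2_eq_square)
  also have "\<dots> = 0" using assms(1,2) by simp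
  finally have "Y - Y' = 0 \<or> 1 - T - c * (Y + Y') = 0" by simp
  moreover have "fps_nth (1 - T - c * (Y + Y')) 0 \<noteq> 0"
    using assms(3-5) by simp
  ultimately show ?thesis by (metis eq_iff_diff_eq_0 fps_zero_nth)
qed

text \<open>Substituting \<open>T\<close> into the quadratic equation yields the equation assumed
  for \<open>Y\<close>. Both layers of trees identify their composed series in this way, without
  computing coefficients.\<close>

lemma quad_series_compose_unique:
  fixes T :: "'r::idom fps"
  assumes "Y = T * (1 + Y) + fps_const r * Y ^ 2" "fps_nth Y 0 = 0" "fps_nth T 0 = 0"
  shows "quad_series r oo T = Y"
proof (rule quadratic_unique [of _ T "fps_const r"])
  have "quad_series r oo T = (fps_X * (1 + quad_series r) + fps_const r * quad_series r ^ 2) oo T"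
    by (subst quad_series_eq) (rule refl)
  also have "\<dots> = T * (1 + (quad_series r oo T)) + fps_const r * (quad_series r oo T) ^ 2"
    using assms(3)
    by (simp add: fps_compose_add_distrib fps_compose_mult_distrib power2_eq_square)
  finally show "quad_series r oo T = \<dots>" .
qed (use assms in auto)

section \<open>Cactus words\<close>

text \<open>The conditions on cacti cells, with the forbidden pattern stated through subsequences so
  that it can be analysed along appends. Letters have arbitrary type because the recursion passes to
  arbitrary subsets of the alphabet.\<close>

definition cactus_word :: "'a list \<Rightarrow> bool" where
  "cactus_word w \<longleftrightarrow> distinct_adj w \<and> (\<forall>x y. x \<noteq> y \<longrightarrow> \<not> subseq [x, y, x, y] w)"

lemma subseq_Cons_iff_nth:
  "subseq (x # xs) w \<longleftrightarrow> (\<exists>i<length w. w ! i = x \<and> subseq xs (drop (Suc i) w))"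
proof
  assume "subseq (x # xs) w"
  then obtain us v vs where "w = us @ v # vs" "x = v" "subseq xs vs"
    by (auto dest: list_emb_ConsD)
  thus "\<exists>i<length w. w ! i = x \<and> subseq xs (drop (Suc i) w)"
    by (intro exI [of _ "length us"]) auto
next
  assume "\<exists>i<length w. w ! i = x \<and> subseq xs (drop (Suc i) w)"
  then obtain i where i: "i < length w" "w ! i = x" "subseq xs (drop (Suc i) w)" by auto
  have "subseq (x # xs) (take i w @ x # drop (Suc i) w)"
    using i(3) by (intro subseq_drop_many) simp
  thus "subseq (x # xs) w" using i id_take_nth_drop [of i w] by simp
qed

lemma subseq_alternating_iff_nth:
  "(\<exists>x y. x \<noteq> y \<and> subseq [x, y, x, y] w) \<longleftrightarrow>
   (\<exists>a b c d. a < b \<and> b < c \<and> c < d \<and> d < length w \<and>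
      w ! a = w ! c \<and> w ! b = w ! d \<and> w ! a \<noteq> w ! b)"
proof
  assume "\<exists>x y. x \<noteq> y \<and> subseq [x, y, x, y] w"
  \<comment> \<open>Each index counts from just after the previous letter; the sums are the absolute
    positions.\<close>
  then obtain x y i j k l where "x \<noteq> y" "i < length w" "w ! i = x"
    "Suc i + j < length w" "w ! (Suc i + j) = y"
    "Suc (Suc (i + j) + k) < length w" "w ! Suc (Suc (i + j) + k) = x"
    "Suc (Suc (Suc (i + j) + k) + l) < length w" "w ! Suc (Suc (Suc (i + j) + k) + l) = y"
    by (auto simp: subseq_Cons_iff_nth add_ac less_diff_conv simp del: list_emb_Cons_iff1 list_emb_Cons_iff2)
  thus "\<exists>a b c d. a < b \<and> b < c \<and> c < d \<and> d < length w \<and>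
      w ! a = w ! c \<and> w ! b = w ! d \<and> w ! a \<noteq> w ! b"
    by (intro exI [of _ i] exI [of _ "Suc i + j"] exI [of _ "Suc (Suc (i + j) + k)"]
          exI [of _ "Suc (Suc (Suc (i + j) + k) + l)"]) simp
next
  assume "\<exists>a b c d. a < b \<and> b < c \<and> c < d \<and> d < length w \<and>
      w ! a = w ! c \<and> w ! b = w ! d \<and> w ! a \<noteq> w ! b"
  then obtain a b c d where *: "a < b" "b < c" "c < d" "d < length w"
    "w ! a = w ! c" "w ! b = w ! d" "w ! a \<noteq> w ! b" by blast
  \<comment> \<open>The pattern is assembled from its last letter, each position being shifted to
    the suffix in which it is sought.\<close>
  have "subseq [w ! d] (drop (Suc c) w)"
    unfolding subseq_Cons_iff_nth using * by (intro exI [of _ "d - Suc c"]) simp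
  hence "subseq [w ! c, w ! d] (drop (Suc b) w)"
    unfolding subseq_Cons_iff_nth [of "w ! c"] using * by (intro exI [of _ "c - Suc b"]) simp
  hence "subseq [w ! b, w ! c, w ! d] (drop (Suc a) w)"
    unfolding subseq_Cons_iff_nth [of "w ! b"] using * by (intro exI [of _ "b - Suc a"]) simp
  hence "subseq [w ! a, w ! b, w ! c, w ! d] w"
    unfolding subseq_Cons_iff_nth [of "w ! a"] using * by (intro exI [of _ a]) simp
  thus "\<exists>x y. x \<noteq> y \<and> subseq [x, y, x, y] w" using * by metis
qed

definition cactus_words :: "'a set \<Rightarrow> 'a list set" where
  "cactus_words A = {w. cactus_word w \<and> set w = A}"

lemma cacti_cells_eq: "cacti_cells k = cactus_words {1..k}"
proof -
  have "cactus_word w \<longleftrightarrow> distinct_adj w \<and> \<not> (\<exists>x y. x \<noteq> y \<and> subseq [x, y, x, y] w)" for w :: "nat list"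
    by (simp only: cactus_word_def not_ex de_Morgan_conj imp_conv_disj)
  thus ?thesis
    by (simp only: cacti_cells_def cactus_words_def distinct_adj_conv_nth subseq_alternating_iff_nth conj_ac)
qed

lemma cactus_word_Nil [simp]: "cactus_word []"
  by (simp add: cactus_word_def)

lemma subseq_set: "subseq xs ys \<Longrightarrow> set xs \<subseteq> set ys"
  by (induction rule: list_emb.induct) auto

text \<open>Both letters of the forbidden pattern occur twice, so a letter that occurs only once
  takes no part in it.\<close>

lemma cactus_word_Cons_fresh:
  assumes "a \<notin> set r"
  shows "cactus_word (a # r) \<longleftrightarrow> cactus_word r"
proof -
  have "distinct_adj (a # r) \<longleftrightarrow> distinct_adj r"
    using assms by (cases r) auto
  moreover have "subseq [x, y, x, y] (a # r) \<longleftrightarrow> subseq [x, y, x, y] r" for x y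
  proof
    assume s: "subseq [x, y, x, y] (a # r)"
    show "subseq [x, y, x, y] r"
    proof (cases "x = a")
      case True
      hence "subseq [y, a, y] r" using s by simp
      hence "a \<in> set r" using subseq_set [of "[y, a, y]" r] by simp
      thus ?thesis using assms by simp
    qed (use s in simp)
  qed (rule list_emb_Cons)
  ultimately show ?thesis by (simp add: cactus_word_def)
qed

text \<open>A letter \<open>y\<close> common to \<open>u\<close> and \<open>v\<close> would give the
  pattern \<open>a y a y\<close>. Conversely, if \<open>u\<close> shares no letter with
  \<open>a # v\<close>, no alternating pattern can straddle the second \<open>a\<close>.\<close>

lemma cactus_word_return:
  assumes a: "a \<notin> set u"
  shows "cactus_word (a # u @ a # v) \<longleftrightarrow>
    u \<noteq> [] \<and> cactus_word u \<and> cactus_word (a # v) \<and> set u \<inter> set (a # v) = {}"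
proof
  assume c: "cactus_word (a # u @ a # v)"
  hence "u \<noteq> []" by (auto simp: cactus_word_def)
  \<comment> \<open>Being a cactus word passes to contiguous factors, and \<open>u\<close> and
    \<open>a # v\<close> are two of them.\<close>
  moreover have "cactus_word s" if "\<exists>p q. a # u @ a # v = p @ s @ q" for s
  proof -
    from that obtain p q where pq: "a # u @ a # v = p @ s @ q" by auto
    have "distinct_adj s" using c unfolding cactus_word_def pq by (auto simp: distinct_adj_append_iff)
    moreover have "subseq s (p @ s @ q)" by (simp add: subseq_drop_many subseq_rev_drop_many)
    ultimately show ?thesis using c unfolding cactus_word_def pq
      using subseq_order.order_trans by blast
  qed
  from this [of u] this [of "a # v"] have "cactus_word u" "cactus_word (a # v)"
    by (metis append.left_neutral append_Cons append_Nil2)+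
  moreover have "y \<notin> set v" if "y \<in> set u" for y
  proof
    assume "y \<in> set v"
    hence "subseq [y] u" "subseq [y] v" using that by (auto simp: subseq_singleton_left)
    hence "subseq ([y] @ [a, y]) (u @ a # v)"
      by (intro list_emb_append_mono) auto
    hence "subseq [a, y, a, y] (a # u @ a # v)" by simp
    moreover have "a \<noteq> y" using that a by auto
    ultimately show False using c unfolding cactus_word_def by blast
  qed
  ultimately show "u \<noteq> [] \<and> cactus_word u \<and> cactus_word (a # v) \<and> set u \<inter> set (a # v) = {}"
    using a by auto
next
  assume "u \<noteq> [] \<and> cactus_word u \<and> cactus_word (a # v) \<and> set u \<inter> set (a # v) = {}"
  hence u: "u \<noteq> []" "cactus_word u" and v: "cactus_word (a # v)"
    and disj: "set u \<inter> set (a # v) = {}" by auto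
  have "distinct_adj (a # u @ a # v)"
    using u v a by (auto simp: cactus_word_def distinct_adj_append_iff distinct_adj_Cons)
  moreover have False if "x \<noteq> y" "subseq [x, y, x, y] ((a # u) @ (a # v))" for x y
  proof -
    from that(2) obtain p q where pq: "[x, y, x, y] = p @ q" "subseq p (a # u)" "subseq q (a # v)"
      by (auto simp only: subseq_append_iff)
    have sets: "set p \<subseteq> insert a (set u)" "set q \<subseteq> insert a (set v)"
      using subseq_set [OF pq(2)] subseq_set [OF pq(3)] by auto
    have split: "p = take (length p) [x, y, x, y]" "q = drop (length p) [x, y, x, y]"
      by (simp_all add: pq(1))
    have "length p \<le> length [x, y, x, y]" by (simp only: pq(1) length_append)
    hence "length p = 0 \<or> length p = 1 \<or> length p = 2 \<or> length p = 3 \<or> length p = 4"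
      by (simp add: numeral_eq_Suc le_Suc_eq)
    \<comment> \<open>The ways to cut \<open>x y x y\<close> between \<open>a # u\<close> and
      \<open>a # v\<close>. The only letter common to both halves is \<open>a\<close>, so in the
      mixed cases a letter used on both sides must be \<open>a\<close>.\<close>
    then consider "p = []" "q = [x, y, x, y]" | "p = [x]" "q = [y, x, y]" | "p = [x, y]" "q = [x, y]"
      | "p = [x, y, x]" "q = [y]" | "p = [x, y, x, y]" "q = []"
      by (elim disjE) (insert split, simp_all add: numeral_eq_Suc)
    thus False
    proof cases
      case 1
      thus False using pq v that(1) by (auto simp: cactus_word_def)
    next
      case 2
      hence "x = a" using sets disj by auto
      hence "subseq [y, a, y] v" using 2 pq(3) that(1) by simp
      hence "subseq [a, y, a, y] (a # v)" by simp
      thus False using v that(1) \<open>x = a\<close> unfolding cactus_word_def by blast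
    next
      case 3
      thus False using sets disj that(1) by auto
    next
      case 4
      hence "y = a" using sets disj by auto
      hence "subseq [x, a, x] u" using 4 pq(2) that(1) by simp
      thus False using subseq_set a by fastforce
    next
      case 5
      moreover have "cactus_word (a # u)" using u a by (simp add: cactus_word_Cons_fresh)
      ultimately show False using pq(2) that(1) by (auto simp: cactus_word_def)
    qed
  qed
  ultimately show "cactus_word (a # u @ a # v)"
    unfolding cactus_word_def by (metis append_Cons)
qed

section \<open>Decomposition and enumeration of cactus words\<close>

text \<open>\<open>U\<close> is the set of letters strictly between the first two occurrences of
  \<open>a\<close>; it is nonempty because equal letters are never adjacent. The part
  \<open>v\<close> begins with the second \<open>a\<close>, so it is again a word starting with
  \<open>a\<close>.\<close>

lemma cactus_words_starting_decomp:
  fixes A :: "'a set"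
  assumes "a \<in> A"
  defines "C \<equiv> (\<lambda>B. {w \<in> cactus_words B. w \<noteq> [] \<and> hd w = a})"
  defines "D \<equiv> (SIGMA U:Pow (A - {a}) - {{}}. cactus_words U \<times> C (A - U))"
  shows "C A = (#) a ` cactus_words (A - {a}) \<union> (\<lambda>(U, u, v). a # u @ v) ` D"
    and "(#) a ` cactus_words (A - {a}) \<inter> (\<lambda>(U, u, v). a # u @ v) ` D = {}"
    and "inj_on (\<lambda>(U, u, v). a # u @ v) D"
proof -
  have hdC: "\<exists>v'. v = a # v'" if "v \<in> C B" for v B
    using that by (cases v) (auto simp: C_def)
  show "C A = (#) a ` cactus_words (A - {a}) \<union> (\<lambda>(U, u, v). a # u @ v) ` D"
  proof (intro equalityI subsetI)
    fix w assume "w \<in> C A"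
    then obtain r where w: "w = a # r" "cactus_word w" "set w = A"
      by (cases w) (auto simp: C_def cactus_words_def)
    show "w \<in> (#) a ` cactus_words (A - {a}) \<union> (\<lambda>(U, u, v). a # u @ v) ` D"
    proof (cases "a \<in> set r")
      case False
      hence "r \<in> cactus_words (A - {a})"
        using w by (auto simp: cactus_words_def cactus_word_Cons_fresh)
      thus ?thesis using w by auto
    next
      case True
      then obtain u v where uv: "r = u @ a # v" "a \<notin> set u"
        using split_list_first by metis
      have *: "u \<noteq> []" "cactus_word u" "cactus_word (a # v)" "set u \<inter> set (a # v) = {}"
        using w uv cactus_word_return [OF uv(2), of v] by auto
      have "A - set u = set (a # v)" "set u \<subseteq> A - {a}" using * w uv by auto
      hence "(set u, u, a # v) \<in> D"
        using * by (simp add: D_def C_def cactus_words_def)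
      from imageI [OF this, of "\<lambda>(U, u, v). a # u @ v"] show ?thesis
        unfolding w(1) uv(1) by simp
    qed
  next
    fix w assume "w \<in> (#) a ` cactus_words (A - {a}) \<union> (\<lambda>(U, u, v). a # u @ v) ` D"
    thus "w \<in> C A"
    proof
      assume "w \<in> (#) a ` cactus_words (A - {a})"
      then obtain r where r: "w = a # r" "cactus_word r" "set r = A - {a}"
        by (auto simp: cactus_words_def)
      have "cactus_word w" using r by (simp add: cactus_word_Cons_fresh)
      moreover have "set w = A" using r assms(1) by auto
      ultimately show ?thesis using r(1) by (simp add: C_def cactus_words_def)
    next
      assume "w \<in> (\<lambda>(U, u, v). a # u @ v) ` D"
      then obtain U u v where w: "w = a # u @ v" "U \<subseteq> A - {a}" "U \<noteq> {}" "u \<in> cactus_words U" "v \<in> C (A - U)"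
        by (auto simp: D_def)
      obtain v' where v': "v = a # v'" using hdC w(5) by blast
      have uv: "set u = U" "cactus_word u" "set v = A - U" "cactus_word v"
        using w(4,5) by (simp_all add: cactus_words_def C_def)
      have "a \<notin> set u" using uv(1) w(2) by auto
      moreover have "set u \<inter> set (a # v') = {}" using uv(1,3) v' by blast
      moreover have "u \<noteq> []" using uv(1) w(3) by auto
      ultimately have "cactus_word w"
        using uv(2,4) cactus_word_return [of a u v'] unfolding w(1) v' by simp
      moreover have "set w = A" unfolding w(1) using uv(1,3) w(2) assms(1) by auto
      ultimately show ?thesis using w(1) by (simp add: C_def cactus_words_def)
    qed
  qed
  show "(#) a ` cactus_words (A - {a}) \<inter> (\<lambda>(U, u, v). a # u @ v) ` D = {}"
  proof -
    \<comment> \<open>In a word of the second kind \<open>a\<close> recurs after the first letter;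
      in one of the first kind it does not.\<close>
    have False if "u @ v \<in> cactus_words (A - {a})" "v \<in> C B" for u v B
    proof -
      have "a \<in> set (u @ v)" using hdC [OF that(2)] by auto
      moreover have "set (u @ v) = A - {a}" using that(1) by (simp only: cactus_words_def mem_Collect_eq)
      ultimately have "a \<in> A - {a}" by (rule subst [rotated])
      thus False by simp
    qed
    moreover have "\<exists>u v B. w = a # u @ v \<and> v \<in> C B" if "w \<in> (\<lambda>(U, u, v). a # u @ v) ` D" for w
      using that by (auto simp: D_def)
    ultimately show ?thesis by blast
  qed
  show "inj_on (\<lambda>(U, u, v). a # u @ v) D"
  proof (rule inj_onI)
    fix x y
    assume xy: "x \<in> D" "y \<in> D" "(\<lambda>(U, u, v). a # u @ v) x = (\<lambda>(U, u, v). a # u @ v) y"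
    obtain U u v U' u' v' where x: "x = (U, u, v)" and y: "y = (U', u', v')"
      by (metis surj_pair)
    have D: "(U, u, v) \<in> D" "(U', u', v') \<in> D" and eq: "u @ v = u' @ v'"
      using xy x y by auto
    have "v \<in> C (A - U)" "v' \<in> C (A - U')" using D by (auto simp: D_def)
    then obtain s s' where s: "v = a # s" "v' = a # s'" using hdC by meson
    have set: "set u = U" "set u' = U'" "a \<notin> U" "a \<notin> U'"
      using D by (auto simp: D_def cactus_words_def)
    \<comment> \<open>The part \<open>u\<close> is recovered as the longest prefix free of
      \<open>a\<close>, and then \<open>U\<close> as its set of letters.\<close>
    have "takeWhile (\<lambda>x. x \<noteq> a) (p @ a # q) = p" if "a \<notin> set p" for p q
      using that by (induction p) auto
    hence "u = takeWhile (\<lambda>x. x \<noteq> a) (u @ v)" "u' = takeWhile (\<lambda>x. x \<noteq> a) (u' @ v')"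
      using set s by simp_all
    hence "u = u'" using eq by simp
    thus "x = y" using set eq x y by auto
  qed
qed

lemma cactus_words_empty: "cactus_words {} = {[]}"
  by (auto simp: cactus_words_def)

text \<open>The quadratic equation counts cactus words by returning to the first letter: either that
  letter never recurs, or the word is \<open>a u a v\<close> with \<open>u\<close> nonempty and disjoint from \<open>a v\<close>.\<close>

lemma sum_cactus_words:
  fixes A :: "'a set" and r :: "'r::{comm_ring_1,semiring_char_0}"
  assumes "finite A"
  shows "finite (cactus_words A) \<and>
    (\<Sum>w\<in>cactus_words A. r ^ (length w - card A)) =
       fact (card A) * (if A = {} then 1 else quad_coeff r (card A)) \<and>
    (\<forall>a\<in>A. (\<Sum>w\<in>{w \<in> cactus_words A. w \<noteq> [] \<and> hd w = a}. r ^ (length w - card A)) =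
       fact (card A - 1) * quad_coeff r (card A))"
  using assms
\<comment> \<open>The claims are proved together: cutting a word over \<open>A\<close> calls for the
  full count over \<open>U\<close> and for the count with first letter \<open>a\<close> over
  \<open>A - U\<close>.\<close>
proof (induction "card A" arbitrary: A rule: less_induct)
  case less
  note fin [simp] = less.prems
  show ?case
  proof (cases "A = {}")
    case True
    thus ?thesis by (simp add: cactus_words_empty)
  next
    case False
    define C where "C a B = {w \<in> cactus_words B. w \<noteq> [] \<and> hd w = a}" for a and B :: "'a set"
    have C: "finite (C a A) \<and>
       (\<Sum>w\<in>C a A. r ^ (length w - card A)) = fact (card A - 1) * quad_coeff r (card A)"
      if a: "a \<in> A" for a
    proof -
      define n where "n = card (A - {a})"
      have n: "card A = Suc n" using a card_Suc_Diff1 [OF fin a] by (simp add: n_def)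
      define D where "D = (SIGMA U:Pow (A - {a}) - {{}}. cactus_words U \<times> C a (A - U))"
      note dec = cactus_words_starting_decomp [OF a, folded C_def, folded D_def]
      have small: "card U < card A" "card (A - U) < card A" "card U \<le> n" "card (A - U) = Suc n - card U" "finite U"
        if "U \<in> Pow (A - {a}) - {{}}" for U
      proof -
        have "U \<subset> A" using that a by auto
        thus "card U < card A" by (simp add: psubset_card_mono)
        show "finite U" using that finite_subset [of U A] by auto
        show "card (A - U) < card A" using that a by (intro psubset_card_mono) auto
        show "card U \<le> n" unfolding n_def using that by (intro card_mono) auto
        show "card (A - U) = Suc n - card U"
          using \<open>U \<subset> A\<close> \<open>finite U\<close> n by (simp add: card_Diff_subset)
      qed
      have small0: "card (A - {a}) < card A" using n n_def by simp
      note IH0 = less.hyps [OF small0]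
      have IHU: "finite (cactus_words U)"
          "(\<Sum>w\<in>cactus_words U. r ^ (length w - card U)) = fact (card U) * quad_coeff r (card U)"
          "finite (C a (A - U))"
          "(\<Sum>w\<in>C a (A - U). r ^ (length w - card (A - U))) = fact (n - card U) * quad_coeff r (Suc n - card U)"
        if "U \<in> Pow (A - {a}) - {{}}" for U
        using less.hyps [OF small(1) [OF that]] less.hyps [OF small(2) [OF that]] small [OF that] that a
        by (auto simp: C_def)
      have finD: "finite D" unfolding D_def using IHU(1,3)
        by (intro finite_SigmaI finite_Diff) auto
      have "finite (cactus_words (A - {a}))" using IH0 by simp
      hence "finite (C a A)" unfolding dec(1) using finD by simp
      have "(\<Sum>w\<in>C a A. r ^ (length w - card A)) =
        (\<Sum>w\<in>cactus_words (A - {a}). r ^ (length (a # w) - card A)) +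
        (\<Sum>(U, u, v)\<in>D. r ^ (length (a # u @ v) - card A))"
        unfolding dec(1) using finD \<open>finite (cactus_words (A - {a}))\<close> dec(2,3)
        by (subst sum.union_disjoint)
          (auto simp: sum.reindex case_prod_unfold)
      \<comment> \<open>For \<open>n = 0\<close> the remainder is the empty word, of weight 1,
        although \<open>quad_coeff r 0 = 0\<close>.\<close>
      also have "(\<Sum>w\<in>cactus_words (A - {a}). r ^ (length (a # w) - card A)) =
          fact n * (if n = 0 then 1 else quad_coeff r n)"
        using IH0 n_def n by auto
      also have "(\<Sum>(U, u, v)\<in>D. r ^ (length (a # u @ v) - card A)) =
        (\<Sum>U\<in>Pow (A - {a}) - {{}}. \<Sum>u\<in>cactus_words U. \<Sum>v\<in>C a (A - U). r ^ (length (a # u @ v) - card A))"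
        unfolding D_def sum.cartesian_product using IHU
        by (subst sum.Sigma [symmetric]) (auto simp: case_prod_unfold)
      also have "\<dots> = (\<Sum>U\<in>Pow (A - {a}) - {{}}.
          r * ((fact (card U) * quad_coeff r (card U)) * (fact (n - card U) * quad_coeff r (Suc n - card U))))"
      proof (intro sum.cong refl)
        fix U assume U: "U \<in> Pow (A - {a}) - {{}}"
        \<comment> \<open>The leading \<open>a\<close> lengthens the word but brings no new letter,
          since \<open>a\<close> already lies in \<open>A - U\<close>; this gives the factor
          \<open>r\<close>.\<close>
        have "r ^ (length (a # u @ v) - card A) =
            r * (r ^ (length u - card U) * r ^ (length v - card (A - U)))"
          if "u \<in> cactus_words U" "v \<in> C a (A - U)" for u v
        proof -
          have "card U \<le> length u" "card (A - U) \<le> length v"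
            using that card_length [of u] card_length [of v] by (auto simp: cactus_words_def C_def)
          hence "length (a # u @ v) - card A = Suc ((length u - card U) + (length v - card (A - U)))"
            using small [OF U] n by simp
          thus ?thesis by (simp add: power_add)
        qed
        hence "(\<Sum>u\<in>cactus_words U. \<Sum>v\<in>C a (A - U). r ^ (length (a # u @ v) - card A)) =
           (\<Sum>u\<in>cactus_words U. \<Sum>v\<in>C a (A - U). r * (r ^ (length u - card U) * r ^ (length v - card (A - U))))"
          by (intro sum.cong refl) auto
        also have "\<dots> = r * ((\<Sum>u\<in>cactus_words U. r ^ (length u - card U)) *
            (\<Sum>v\<in>C a (A - U). r ^ (length v - card (A - U))))"
          by (subst sum_product) (simp add: sum_distrib_left)
        finally show "(\<Sum>u\<in>cactus_words U. \<Sum>v\<in>C a (A - U). r ^ (length (a # u @ v) - card A)) =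
          r * ((fact (card U) * quad_coeff r (card U)) * (fact (n - card U) * quad_coeff r (Suc n - card U)))"
          using IHU [OF U] by simp
      qed
      \<comment> \<open>The empty \<open>U\<close> may join the sum because
        \<open>quad_coeff r 0 = 0\<close>.\<close>
      also have "\<dots> = (\<Sum>U\<in>Pow (A - {a}).
          r * ((fact (card U) * quad_coeff r (card U)) * (fact (n - card U) * quad_coeff r (Suc n - card U))))"
        by (rule sum.mono_neutral_left) auto
      \<comment> \<open>Since \<open>card U \<le> n\<close>, the second factor is a function of
        \<open>n - card U\<close>, the form that \<open>sum_Pow_fact\<close> expects.\<close>
      also have "\<dots> = (\<Sum>U\<in>Pow (A - {a}).
          r * ((fact (card U) * quad_coeff r (card U)) * (fact (n - card U) * quad_coeff r (Suc (n - card U)))))"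
      proof (intro sum.cong refl)
        fix U assume "U \<in> Pow (A - {a})"
        hence "card U \<le> n" unfolding n_def by (intro card_mono) auto
        thus "r * ((fact (card U) * quad_coeff r (card U)) * (fact (n - card U) * quad_coeff r (Suc n - card U))) =
          r * ((fact (card U) * quad_coeff r (card U)) * (fact (n - card U) * quad_coeff r (Suc (n - card U))))"
          by (simp only: Suc_diff_le)
      qed
      also have "\<dots> = r * (fact n * (\<Sum>j\<le>n. quad_coeff r j * quad_coeff r (Suc (n - j))))"
      proof -
        have "finite (A - {a})" by simp
        from sum_Pow_fact [OF this, of "quad_coeff r" "\<lambda>j. quad_coeff r (Suc j)", folded n_def]
        show ?thesis by (simp only: sum_distrib_left [symmetric, of r])
      qed
      also have "(\<Sum>j\<le>n. quad_coeff r j * quad_coeff r (Suc (n - j))) =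
          (\<Sum>j\<in>{1..n}. quad_coeff r j * quad_coeff r (Suc n - j))"
      proof (rule sum.mono_neutral_cong_right)
        show "\<forall>j\<in>{..n} - {1..n}. quad_coeff r j * quad_coeff r (Suc (n - j)) = 0"
        proof
          fix j assume "j \<in> {..n} - {1..n}"
          hence "j = 0" by auto
          thus "quad_coeff r j * quad_coeff r (Suc (n - j)) = 0" by (simp only: quad_coeff.simps mult_zero_left)
        qed
      qed (simp_all only: Suc_diff_le atLeastAtMost_iff finite_atMost, auto)
      finally have "(\<Sum>w\<in>C a A. r ^ (length w - card A)) = fact n * quad_coeff r (Suc n)"
        by (simp only: quad_coeff.simps distrib_left mult_ac)
      thus ?thesis using \<open>finite (C a A)\<close> n by simp
    qed
    \<comment> \<open>Sorting by first letter gives \<open>card A\<close> classes of equal weight,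
      which raises \<open>fact (card A - 1)\<close> to \<open>fact (card A)\<close>.\<close>
    have U: "cactus_words A = (\<Union>a\<in>A. C a A)"
    proof (intro equalityI subsetI)
      fix w assume w: "w \<in> cactus_words A"
      hence "set w = A" by (simp add: cactus_words_def)
      moreover from this have "w \<noteq> []" using False by auto
      ultimately have "w \<noteq> []" "hd w \<in> A" using hd_in_set by auto
      thus "w \<in> (\<Union>a\<in>A. C a A)" using w by (auto simp: C_def)
    qed (auto simp: C_def)
    have "(\<Sum>w\<in>cactus_words A. r ^ (length w - card A)) =
        (\<Sum>a\<in>A. \<Sum>w\<in>C a A. r ^ (length w - card A))"
      unfolding U using C by (intro sum.UNION_disjoint) (auto simp: C_def)
    also have "\<dots> = of_nat (card A) * (fact (card A - 1) * quad_coeff r (card A))"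
      using C by simp
    also have "\<dots> = fact (card A) * quad_coeff r (card A)"
      using False fact_reduce [of "card A", where ?'a = 'r]
      by (simp add: card_gt_0_iff mult.assoc)
    finally have "(\<Sum>w\<in>cactus_words A. r ^ (length w - card A)) = fact (card A) * quad_coeff r (card A)" .
    moreover have "finite (cactus_words A)" unfolding U using C by auto
    ultimately show ?thesis using False C unfolding C_def by auto
  qed
qed

lemma finite_cacti_cells: "finite (cacti_cells k)"
  using sum_cactus_words [of "{1..k}" "0::int"] by (simp add: cacti_cells_eq)

text \<open>The case \<open>k = 0\<close> differs: \<open>cacti_cells 0\<close> contains the empty
  word, while \<open>quad_coeff r 0\<close> is 0.\<close>

lemma sum_cacti_cells:
  fixes r :: "'r::{comm_ring_1,semiring_char_0}"
  assumes "k > 0"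
  shows "(\<Sum>w\<in>cacti_cells k. r ^ cacti_dim w) = fact k * quad_coeff r k"
proof -
  have "(\<Sum>w\<in>cacti_cells k. r ^ cacti_dim w) = (\<Sum>w\<in>cactus_words {1..k}. r ^ (length w - card {1..k}))"
    unfolding cacti_cells_eq by (intro sum.cong refl) (auto simp: cacti_dim_def cactus_words_def)
  thus ?thesis using assms sum_cactus_words [of "{1..k}" r] by simp
qed

section \<open>Nested trees\<close>

text \<open>\<open>T ^ n\<close> counts sequences of \<open>n\<close> nonempty blocks, and each
  partition into \<open>n\<close> blocks can be ordered in \<open>fact n\<close> ways. The induction
  removes one distinguished block.\<close>

lemma fps_power_partition_sum:
  fixes T :: "'r::{comm_ring_1,semiring_char_0} fps" and f :: "'a set \<Rightarrow> 'r"
  assumes "finite L" "fps_nth T 0 = 0"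
    and "\<And>B. B \<subseteq> L \<Longrightarrow> B \<noteq> {} \<Longrightarrow> f B = fact (card B) * fps_nth T (card B)"
  shows "fact n * (\<Sum>\<pi> | partition_on L \<pi> \<and> card \<pi> = n. \<Prod>B\<in>\<pi>. f B) =
    fact (card L) * fps_nth (T ^ n) (card L)"
  using assms(1,3)
proof (induction n arbitrary: L)
  case 0
  have "{\<pi>. partition_on L \<pi> \<and> card \<pi> = 0} = (if L = {} then {{}} else {})"
    using finite_elements [OF 0(1)] by (auto simp: partition_on_def)
  thus ?case using 0(1) by auto
next
  case (Suc n)
  define P where "P k M = {\<pi>. partition_on M \<pi> \<and> card \<pi> = k}" for k and M :: "'a set"
  have finP: "finite (P k M)" if "finite M" for k M
    unfolding P_def using finitely_many_partition_on [OF that] by (rule rev_finite_subset) auto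
  have finpi: "finite \<pi>" if "\<pi> \<in> P k M" "finite M" for \<pi> k M
    using that finite_elements by (auto simp: P_def)
  have finsub: "finite U" if "U \<in> Pow L - {{}}" for U
    using that Suc.prems(1) finite_subset by blast
  \<comment> \<open>One factor of the factorial is \<open>card \<pi>\<close>, which then becomes the
    choice of a distinguished block.\<close>
  have "fact (Suc n) * (\<Sum>\<pi>\<in>P (Suc n) L. \<Prod>B\<in>\<pi>. f B) =
      fact n * (\<Sum>\<pi>\<in>P (Suc n) L. of_nat (card \<pi>) * (\<Prod>B\<in>\<pi>. f B))"
    by (simp add: P_def sum_distrib_left algebra_simps)
  also have "(\<Sum>\<pi>\<in>P (Suc n) L. of_nat (card \<pi>) * (\<Prod>B\<in>\<pi>. f B)) =
      (\<Sum>\<pi>\<in>P (Suc n) L. \<Sum>B\<in>\<pi>. f B * (\<Prod>B'\<in>\<pi> - {B}. f B'))"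
  proof (intro sum.cong refl)
    fix \<pi> assume "\<pi> \<in> P (Suc n) L"
    hence "finite \<pi>" using finpi Suc.prems(1) by blast
    hence "(\<Sum>B\<in>\<pi>. f B * (\<Prod>B'\<in>\<pi> - {B}. f B')) = (\<Sum>B\<in>\<pi>. \<Prod>B\<in>\<pi>. f B)"
      by (intro sum.cong refl) (simp add: prod.remove [symmetric])
    thus "of_nat (card \<pi>) * (\<Prod>B\<in>\<pi>. f B) = (\<Sum>B\<in>\<pi>. f B * (\<Prod>B'\<in>\<pi> - {B}. f B'))" by simp
  qed
  also have "\<dots> = (\<Sum>(\<pi>, B)\<in>(SIGMA \<pi>:P (Suc n) L. \<pi>). f B * (\<Prod>B'\<in>\<pi> - {B}. f B'))"
    using finP finpi Suc.prems(1) by (intro sum.Sigma) auto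
  \<comment> \<open>A partition with a distinguished block is a nonempty \<open>U\<close> together
    with a partition of the complement.\<close>
  also have "\<dots> = (\<Sum>(U, \<rho>)\<in>(SIGMA U:Pow L - {{}}. P n (L - U)). f U * (\<Prod>B\<in>\<rho>. f B))"
  proof (rule sum.reindex_bij_witness
      [of _ "\<lambda>(U, \<rho>). (insert U \<rho>, U)" "\<lambda>(\<pi>, B). (B, \<pi> - {B})"])
    fix x assume "x \<in> (SIGMA \<pi>:P (Suc n) L. \<pi>)"
    then obtain \<pi> B where x: "x = (\<pi>, B)" "partition_on L \<pi>" "card \<pi> = Suc n" "B \<in> \<pi>"
      by (auto simp: P_def)
    have ins: "insert B (\<pi> - {B}) = \<pi>" using x by auto
    have disj: "disjnt B (\<Union>(\<pi> - {B}))"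
      using x(2,4) by (auto simp: partition_on_def disjoint_def disjnt_def)
    have "partition_on (L - B) (\<pi> - {B})" "B \<subseteq> L" "B \<noteq> {}"
      using partition_on_insert [OF disj, of L] x(2) unfolding ins by auto
    moreover have "card (\<pi> - {B}) = n" using x(3,4) by simp
    ultimately show "(case x of (\<pi>, B) \<Rightarrow> (B, \<pi> - {B})) \<in> (SIGMA U:Pow L - {{}}. P n (L - U))"
      using x(1) by (simp add: P_def)
    show "(case case x of (\<pi>, B) \<Rightarrow> (B, \<pi> - {B}) of (U, \<rho>) \<Rightarrow> (insert U \<rho>, U)) = x"
      using x(1) ins by simp
    show "(case case x of (\<pi>, B) \<Rightarrow> (B, \<pi> - {B}) of (U, \<rho>) \<Rightarrow> f U * prod f \<rho>) =
         (case x of (\<pi>, B) \<Rightarrow> f B * prod f (\<pi> - {B}))"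
      using x(1) by simp
  next
    fix x assume "x \<in> (SIGMA U:Pow L - {{}}. P n (L - U))"
    then obtain U \<rho> where x: "x = (U, \<rho>)" "U \<subseteq> L" "U \<noteq> {}" "partition_on (L - U) \<rho>" "card \<rho> = n"
      by (auto simp: P_def)
    have disj: "disjnt U (\<Union>\<rho>)" using x(4) by (auto simp: partition_on_def disjnt_def)
    hence U: "U \<notin> \<rho>" using x(3) by (auto simp: disjnt_def)
    have "finite \<rho>" using finite_elements x(4) Suc.prems(1) by blast
    hence "card (insert U \<rho>) = Suc n" using U x(5) by simp
    moreover have "partition_on L (insert U \<rho>)" using partition_on_insert [OF disj] x by simp
    ultimately show "(case x of (U, \<rho>) \<Rightarrow> (insert U \<rho>, U)) \<in> (SIGMA \<pi>:P (Suc n) L. \<pi>)"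
      using x(1) by (simp add: P_def)
    show "(case case x of (U, \<rho>) \<Rightarrow> (insert U \<rho>, U) of (\<pi>, B) \<Rightarrow> (B, \<pi> - {B})) = x"
      using x(1) U by simp
  qed
  also have "\<dots> = (\<Sum>U\<in>Pow L - {{}}. f U * (\<Sum>\<rho>\<in>P n (L - U). \<Prod>B\<in>\<rho>. f B))"
    using finP Suc.prems(1) by (subst sum.Sigma [symmetric]) (auto simp: sum_distrib_left)
  also have "fact n * \<dots> = (\<Sum>U\<in>Pow L - {{}}. f U * (fact n * (\<Sum>\<rho>\<in>P n (L - U). \<Prod>B\<in>\<rho>. f B)))"
    by (subst sum_distrib_left) (simp only: mult.left_commute)
  also have "\<dots> = (\<Sum>U\<in>Pow L - {{}}. (fact (card U) * fps_nth T (card U)) *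
      (fact (card L - card U) * fps_nth (T ^ n) (card L - card U)))"
  proof (intro sum.cong refl)
    fix U assume U: "U \<in> Pow L - {{}}"
    have "fact n * (\<Sum>\<rho>\<in>P n (L - U). \<Prod>B\<in>\<rho>. f B) =
        fact (card (L - U)) * fps_nth (T ^ n) (card (L - U))"
      unfolding P_def using U Suc.prems by (intro Suc.IH) auto
    moreover have "card (L - U) = card L - card U" using U finsub by (intro card_Diff_subset) auto
    moreover have "f U = fact (card U) * fps_nth T (card U)" using U Suc.prems(2) by auto
    ultimately show "f U * (fact n * (\<Sum>\<rho>\<in>P n (L - U). \<Prod>B\<in>\<rho>. f B)) =
        (fact (card U) * fps_nth T (card U)) * (fact (card L - card U) * fps_nth (T ^ n) (card L - card U))"
      by simp
  qed
  \<comment> \<open>The empty \<open>U\<close> contributes 0 because \<open>T\<close> has no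
    constant term.\<close>
  also have "\<dots> = (\<Sum>U\<in>Pow L. (fact (card U) * fps_nth T (card U)) *
      (fact (card L - card U) * fps_nth (T ^ n) (card L - card U)))"
    using Suc.prems(1) assms(2) by (intro sum.mono_neutral_left) auto
  also have "\<dots> = fact (card L) * (\<Sum>j\<le>card L. fps_nth T j * fps_nth (T ^ n) (card L - j))"
    by (rule sum_Pow_fact [OF Suc.prems(1)])
  also have "(\<Sum>j\<le>card L. fps_nth T j * fps_nth (T ^ n) (card L - j)) = fps_nth (T ^ Suc n) (card L)"
    by (simp add: fps_mult_nth atLeast0AtMost)
  finally show ?case unfolding P_def .
qed

section \<open>Nested trees and the edges at the root\<close>

lemma nested_treeD:
  assumes "nested_tree L S"
  shows "L \<in> S" "finite L" "finite S" "card L \<ge> 2"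
    and "V \<in> S \<Longrightarrow> V \<subseteq> L" "V \<in> S \<Longrightarrow> card V \<ge> 2" "V \<in> S \<Longrightarrow> V \<noteq> {}"
    and "V \<in> S \<Longrightarrow> W \<in> S \<Longrightarrow> V \<inter> W = {} \<or> V \<subseteq> W \<or> W \<subseteq> V"
proof -
  note d = assms [unfolded nested_tree_def]
  show "L \<in> S" "V \<in> S \<Longrightarrow> V \<subseteq> L" "V \<in> S \<Longrightarrow> card V \<ge> 2"
    "V \<in> S \<Longrightarrow> W \<in> S \<Longrightarrow> V \<inter> W = {} \<or> V \<subseteq> W \<or> W \<subseteq> V" using d by blast+
  thus "V \<in> S \<Longrightarrow> V \<noteq> {}" by auto
  show "card L \<ge> 2" using d by blast
  thus "finite L" by (metis card.infinite not_numeral_le_zero)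
  moreover have "S \<subseteq> Pow L" using d by auto
  ultimately show "finite S" by (simp add: finite_subset)
qed

lemma finite_nested_trees: "finite {S. nested_tree L S}"
proof (cases "finite L")
  case True
  moreover have "{S. nested_tree L S} \<subseteq> Pow (Pow L)" using nested_treeD(5) by blast
  ultimately show ?thesis by (simp add: finite_subset)
next
  case False
  hence "{S. nested_tree L S} = {}" using nested_treeD(2) by blast
  thus ?thesis by simp
qed

lemma finite_entering_edges: "nested_tree L S \<Longrightarrow> V \<in> S \<Longrightarrow> finite (entering_edges S V)"
proof -
  assume "nested_tree L S" "V \<in> S"
  hence "finite V" using nested_treeD(2,5) finite_subset by metis
  moreover have "entering_edges S V \<subseteq> Pow V" by (auto simp: entering_edges_def)
  ultimately show ?thesis by (simp add: finite_subset)
qed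

lemma entering_edgesE:
  assumes "B \<in> entering_edges S V"
  obtains (vertex) "B \<in> S" "B \<subset> V" "\<And>W. W \<in> S \<Longrightarrow> B \<subset> W \<Longrightarrow> \<not> W \<subset> V"
    | (leaf) i where "B = {i}" "i \<in> V" "\<And>W. W \<in> S \<Longrightarrow> i \<in> W \<Longrightarrow> V \<subseteq> W"
proof -
  from assms consider "B \<in> S \<and> B \<subset> V \<and> \<not> (\<exists>W\<in>S. B \<subset> W \<and> W \<subset> V)"
    | "\<exists>i. B = {i} \<and> i \<in> V \<and> (\<forall>W\<in>S. i \<in> W \<longrightarrow> V \<subseteq> W)"
    unfolding entering_edges_def by blast
  thus thesis
  proof cases
    case 1
    show thesis by (rule vertex) (use 1 in blast)+
  next
    case 2
    then obtain i where i: "B = {i}" "i \<in> V" "\<forall>W\<in>S. i \<in> W \<longrightarrow> V \<subseteq> W" by blast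
    show thesis by (rule leaf [OF i(1,2)]) (use i(3) in blast)
  qed
qed

text \<open>The edges entering \<open>V\<close> are decided by the vertices inside \<open>V\<close>:
  by nestedness, any other vertex that meets \<open>V\<close> contains it, as the leaf condition
  demands. Hence vertex weights can be computed within a branch.\<close>

lemma entering_edges_restrict:
  assumes "nested_tree L S" "V \<in> S" "V \<subseteq> B"
  shows "entering_edges {W \<in> S. W \<subseteq> B} V = entering_edges S V"
proof -
  have "V \<subseteq> W" if "i \<in> V" "W \<in> S" "i \<in> W" "\<forall>W\<in>{W \<in> S. W \<subseteq> B}. i \<in> W \<longrightarrow> V \<subseteq> W" for i W
  proof -
    have "V \<inter> W \<noteq> {}" using that by auto
    hence "V \<subseteq> W \<or> W \<subseteq> V" using nested_treeD(8) [OF assms(1,2) that(2)] by blast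
    thus ?thesis using that assms(3) by blast
  qed
  hence "(\<forall>W\<in>{W \<in> S. W \<subseteq> B}. i \<in> W \<longrightarrow> V \<subseteq> W) \<longleftrightarrow> (\<forall>W\<in>S. i \<in> W \<longrightarrow> V \<subseteq> W)" if "i \<in> V" for i
    using that by blast
  moreover have "W \<in> {W \<in> S. W \<subseteq> B} \<and> W \<subset> V \<and> \<not> (\<exists>W'\<in>{W \<in> S. W \<subseteq> B}. W \<subset> W' \<and> W' \<subset> V) \<longleftrightarrow>
      W \<in> S \<and> W \<subset> V \<and> \<not> (\<exists>W'\<in>S. W \<subset> W' \<and> W' \<subset> V)" for W
    using assms(3) by blast
  ultimately show ?thesis unfolding entering_edges_def by (intro arg_cong2 [where f = "(\<union>)"]) auto
qed

text \<open>The block of \<open>i\<close> is a maximal vertex among those strictly inside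
  \<open>L\<close> that contain \<open>i\<close>, or \<open>{i}\<close> if there is none.\<close>

lemma partition_root_edges:
  assumes S: "nested_tree L S"
  shows "partition_on L (entering_edges S L)" "card (entering_edges S L) \<ge> 2"
proof -
  note D = nested_treeD [OF S]
  have block: "\<exists>B\<in>entering_edges S L. i \<in> B" if i: "i \<in> L" for i
  proof (cases "\<forall>W\<in>S. i \<in> W \<longrightarrow> L \<subseteq> W")
    case True
    thus ?thesis using i by (intro bexI [of _ "{i}"]) (auto simp: entering_edges_def)
  next
    case False
    define M where "M = {W \<in> S. i \<in> W \<and> W \<subset> L}"
    from False obtain W where "W \<in> S" "i \<in> W" "\<not> L \<subseteq> W" by blast
    hence "W \<in> M" using D(5) [of W] by (auto simp: M_def)
    moreover have "finite M" using D(3) by (auto simp: M_def)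
    ultimately have "finite M" "M \<noteq> {}" by auto
    then obtain W where W: "W \<in> M" "\<And>W'. W' \<in> M \<Longrightarrow> W \<subseteq> W' \<Longrightarrow> W = W'"
      using finite_has_maximal by metis
    have "W \<in> entering_edges S L" using W unfolding entering_edges_def M_def by blast
    thus ?thesis using W(1) by (auto simp: M_def)
  qed
  have sub: "B \<subset> L \<and> B \<noteq> {}" if "B \<in> entering_edges S L" for B
    using that
  proof (cases rule: entering_edgesE)
    case vertex
    thus ?thesis using D(7) by blast
  next
    case (leaf i)
    have "L \<noteq> {i}" using D(4) by auto
    thus ?thesis using leaf(1,2) by blast
  qed
  have disj: "p = q" if "p \<in> entering_edges S L" "q \<in> entering_edges S L" "p \<inter> q \<noteq> {}" for p q
  proof -
    from that(1) show ?thesis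
    proof (cases rule: entering_edgesE)
      case p: vertex
      from that(2) show ?thesis
      proof (cases rule: entering_edgesE)
        case q: vertex
        show ?thesis using D(8) [OF p(1) q(1)] that(3) p(3) [OF q(1)] q(3) [OF p(1)] p(2) q(2) by blast
      next
        case q: (leaf i)
        show ?thesis using q(3) [OF p(1)] q(1) that(3) p(2) by blast
      qed
    next
      case p: (leaf i)
      from that(2) show ?thesis
      proof (cases rule: entering_edgesE)
        case q: vertex
        show ?thesis using p(3) [OF q(1)] p(1) that(3) q(2) by blast
      next
        case q: (leaf j)
        show ?thesis using p(1) q(1) that(3) by blast
      qed
    qed
  qed
  show part: "partition_on L (entering_edges S L)"
    using block sub disj by (intro partition_onI) (auto simp: disjnt_def, blast+)
  have fin: "finite (entering_edges S L)" using finite_elements [OF D(2) part] .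
  have "entering_edges S L \<noteq> {}" using part D(7) [OF D(1)] by (auto simp: partition_on_def)
  \<comment> \<open>A single block would be all of \<open>L\<close>, but every block is a proper
    subset.\<close>
  moreover have "card (entering_edges S L) \<noteq> 1"
  proof
    assume "card (entering_edges S L) = 1"
    then obtain B where "entering_edges S L = {B}" by (auto simp: card_1_singleton_iff)
    thus False using part sub [of B] by (auto simp: partition_on_def)
  qed
  ultimately show "card (entering_edges S L) \<ge> 2"
    using fin by (metis One_nat_def Suc_1 card_gt_0_iff le_neq_implies_less not_less_eq_eq Suc_leI)
qed

text \<open>A branch sitting over a leaf carries no vertex.\<close>

definition branches :: "'a set \<Rightarrow> 'a set set set" where
  "branches B = (if card B = 1 then {{}} else {N. nested_tree B N})"

definition tree_weight :: "(nat \<Rightarrow> 'r::comm_monoid_mult) \<Rightarrow> 'a set set \<Rightarrow> 'r" where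
  "tree_weight w S = (\<Prod>V\<in>S. w (card (entering_edges S V)))"

lemma finite_branches: "finite (branches B)"
  using finite_nested_trees [of B] by (simp add: branches_def)

lemma branchesD:
  assumes "N \<in> branches B" "V \<in> N"
  shows "nested_tree B N" "V \<subseteq> B" "card V \<ge> 2" "V \<noteq> {}" "card B \<noteq> 1"
proof -
  show "nested_tree B N" "card B \<noteq> 1" using assms by (auto simp: branches_def split: if_splits)
  thus "V \<subseteq> B" "card V \<ge> 2" "V \<noteq> {}" using nested_treeD(5-7) assms(2) by metis+
qed

section \<open>Splitting and grafting at the root\<close>

text \<open>One direction of the correspondence between trees and families of branches over a root
  partition: a tree is cut below its root and can be reassembled from the pieces.\<close>

lemma root_branches:
  assumes S: "nested_tree L S"
  shows "B \<in> entering_edges S L \<Longrightarrow> {V \<in> S. V \<subseteq> B} \<in> branches B"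
    and "insert L (\<Union>B\<in>entering_edges S L. {V \<in> S. V \<subseteq> B}) = S"
proof -
  note D = nested_treeD [OF S]
  show "{V \<in> S. V \<subseteq> B} \<in> branches B" if B: "B \<in> entering_edges S L"
  proof (cases "B \<in> S")
    case True
    hence "card B \<noteq> 1" "card B \<ge> 2" using D(6) by fastforce+
    moreover have "nested_tree B {V \<in> S. V \<subseteq> B}"
      using True D(6,8) by (auto simp: nested_tree_def)
    ultimately show ?thesis by (simp add: branches_def)
  next
    case False
    then obtain i where i: "B = {i}" using B by (auto simp: entering_edges_def)
    have "\<not> V \<subseteq> B" if "V \<in> S" for V
      using D(6) [OF that] card_mono [of B V] i by auto
    thus ?thesis using i by (auto simp: branches_def)
  qed
  \<comment> \<open>The root edge above \<open>V\<close> is the block of any point of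
    \<open>V\<close>. If it is a vertex, its maximality prevents \<open>V\<close> from exceeding it;
    a leaf edge would force \<open>V\<close> to contain \<open>L\<close>.\<close>
  have "\<exists>B\<in>entering_edges S L. V \<subseteq> B" if V: "V \<in> S" "V \<noteq> L" for V
  proof -
    obtain i where i: "i \<in> V" using D(7) V(1) by blast
    have VL: "V \<subset> L" using D(5) V by blast
    then obtain B where B: "B \<in> entering_edges S L" "i \<in> B"
      using partition_root_edges(1) [OF S] i by (auto simp: partition_on_def)
    from B(1) have "V \<subseteq> B"
    proof (cases rule: entering_edgesE)
      case vertex
      thus ?thesis using D(8) [OF V(1) vertex(1)] vertex(3) [OF V(1)] VL i B(2) by blast
    next
      case (leaf j)
      thus ?thesis using leaf(3) [OF V(1)] leaf(1) B(2) i VL by blast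
    qed
    thus ?thesis using B by blast
  qed
  thus "insert L (\<Union>B\<in>entering_edges S L. {V \<in> S. V \<subseteq> B}) = S" using D(1) by blast
qed

text \<open>A block of \<open>Q\<close> shares a point with some block of \<open>P\<close>; both are
  blocks of \<open>Q\<close>, so they coincide.\<close>

lemma partition_on_subset_eq:
  assumes "partition_on L P" "partition_on L Q" "P \<subseteq> Q"
  shows "P = Q"
proof
  show "Q \<subseteq> P"
  proof
    fix X assume X: "X \<in> Q"
    then obtain x where x: "x \<in> X" using assms(2) by (fastforce simp: partition_on_def)
    hence "x \<in> L" using X assms(2) by (auto simp: partition_on_def)
    then obtain B where B: "B \<in> P" "x \<in> B" using assms(1) by (auto simp: partition_on_def)
    have "X = B" using assms(2,3) X x B unfolding partition_on_def disjoint_def by blast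
    thus "X \<in> P" using B by simp
  qed
qed fact

text \<open>The converse direction: grafting branches onto a new root. With at least two blocks
  every block is a proper subset of \<open>L\<close>, so the root is new and the blocks are exactly
  its entering edges.\<close>

lemma graft_branches:
  assumes fin: "finite L" and part: "partition_on L \<pi>" and card: "card \<pi> \<ge> 2"
    and "\<forall>B\<in>\<pi>. g B \<in> branches B"
  defines "S \<equiv> insert L (\<Union>B\<in>\<pi>. g B)"
  shows "nested_tree L S" "entering_edges S L = \<pi>" "\<And>B. B \<in> \<pi> \<Longrightarrow> {V \<in> S. V \<subseteq> B} = g B"
    and "L \<notin> (\<Union>B\<in>\<pi>. g B)" "\<And>B B'. B \<in> \<pi> \<Longrightarrow> B' \<in> \<pi> \<Longrightarrow> B \<noteq> B' \<Longrightarrow> g B \<inter> g B' = {}"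
proof -
  have g: "g B \<in> branches B" if "B \<in> \<pi>" for B using assms(4) that by blast
  have eq: "B = B'" if "B \<in> \<pi>" "B' \<in> \<pi>" "x \<in> B" "x \<in> B'" for B B' x
    using part that by (auto simp: partition_on_def disjoint_def)
  have ne: "B \<noteq> {}" "B \<subseteq> L" if "B \<in> \<pi>" for B
    using part that by (auto simp: partition_on_def)
  have strict: "B \<subset> L" if B: "B \<in> \<pi>" for B
  proof -
    have "\<pi> \<noteq> {B}" using card by auto
    then obtain B' where "B' \<in> \<pi>" "B' \<noteq> B" using B by auto
    moreover from this obtain x where "x \<in> B'" using ne(1) by blast
    ultimately have "x \<in> L" "x \<notin> B" using ne eq B by blast+
    thus ?thesis using ne B by blast
  qed
  have gD: "nested_tree B (g B)" "V \<subseteq> B" "card V \<ge> 2" "V \<noteq> {}" if "B \<in> \<pi>" "V \<in> g B" for B V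
    using branchesD [OF g [OF that(1)] that(2)] by auto
  \<comment> \<open>One point of a vertex determines the branch it belongs to; the remaining claims
    rest on this.\<close>
  have unique: "B = B'" if "B \<in> \<pi>" "B' \<in> \<pi>" "V \<in> g B" "V \<inter> B' \<noteq> {}" for B B' V
    using gD(2) [OF that(1,3)] eq [OF that(1,2)] that(4) by blast
  show "g B \<inter> g B' = {}" if "B \<in> \<pi>" "B' \<in> \<pi>" "B \<noteq> B'" for B B'
  proof (rule ccontr)
    assume "g B \<inter> g B' \<noteq> {}"
    then obtain V where V: "V \<in> g B" "V \<in> g B'" by blast
    have "V \<inter> B' \<noteq> {}" using gD(2,4) [OF that(2) V(2)] by blast
    thus False using unique [OF that(1,2) V(1)] that(3) by blast
  qed
  show L: "L \<notin> (\<Union>B\<in>\<pi>. g B)"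
    using gD(2) strict by blast
  have cardL: "card L \<ge> 2"
  proof -
    have "\<pi> \<noteq> {}" using card by auto
    then obtain B where B: "B \<in> \<pi>" by blast
    have "finite B" using ne(2) [OF B] fin finite_subset by blast
    hence "card B \<ge> 1" using ne(1) [OF B] by (simp add: Suc_le_eq card_gt_0_iff)
    thus ?thesis using psubset_card_mono [OF fin strict [OF B]] by simp
  qed
  show nested: "nested_tree L S"
    unfolding nested_tree_def
  proof (intro conjI ballI)
    show "L \<in> S" by (simp add: S_def)
  next
    fix V assume "V \<in> S"
    thus "V \<subseteq> L" "card V \<ge> 2" using gD(2,3) ne(2) cardL unfolding S_def by blast+
  next
    fix V W assume "V \<in> S" "W \<in> S"
    then consider "V = L \<or> W = L" | B B' where "B \<in> \<pi>" "B' \<in> \<pi>" "V \<in> g B" "W \<in> g B'"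
      unfolding S_def by blast
    thus "V \<inter> W = {} \<or> V \<subseteq> W \<or> W \<subseteq> V"
    proof cases
      case 1
      thus ?thesis using \<open>V \<in> S\<close> \<open>W \<in> S\<close> gD(2) ne(2) unfolding S_def by blast
    next
      case 2
      show ?thesis
      proof (cases "B = B'")
        case True
        thus ?thesis using 2 nested_treeD(8) [OF gD(1) [OF 2(1,3)]] by blast
      next
        case False
        thus ?thesis using 2 unique [OF 2(1,2,3)] gD(2) [OF 2(2,4)] by blast
      qed
    qed
  qed
  show "{V \<in> S. V \<subseteq> B} = g B" if B: "B \<in> \<pi>" for B
  proof
    show "g B \<subseteq> {V \<in> S. V \<subseteq> B}" using gD(2) B by (auto simp: S_def)
    show "{V \<in> S. V \<subseteq> B} \<subseteq> g B"
    proof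
      fix V assume "V \<in> {V \<in> S. V \<subseteq> B}"
      hence V: "V \<in> S" "V \<subseteq> B" by auto
      hence "V \<noteq> L" using strict B by blast
      then obtain B' where B': "B' \<in> \<pi>" "V \<in> g B'" using V by (auto simp: S_def)
      have "V \<inter> B \<noteq> {}" using V(2) gD(4) [OF B'] by auto
      thus "V \<in> g B" using unique [OF B'(1) B B'(2)] B'(2) by simp
    qed
  qed
  \<comment> \<open>One inclusion suffices, since both sides are partitions of
    \<open>L\<close>.\<close>
  have "\<pi> \<subseteq> entering_edges S L"
  proof
    fix B assume B: "B \<in> \<pi>"
    show "B \<in> entering_edges S L"
    proof (cases "card B = 1")
      case True
      then obtain i where i: "B = {i}" by (auto simp: card_1_singleton_iff)
      have "L \<subseteq> W" if "W \<in> S" "i \<in> W" for W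
      proof (rule ccontr)
        assume "\<not> L \<subseteq> W"
        then obtain B' where B': "B' \<in> \<pi>" "W \<in> g B'" using \<open>W \<in> S\<close> by (auto simp: S_def)
        have "B' = B" using unique [OF B'(1) B B'(2)] i that(2) by auto
        thus False using branchesD(5) [OF g [OF B'(1)] B'(2)] True by simp
      qed
      thus ?thesis using i ne(2) [OF B] by (auto simp: entering_edges_def)
    next
      case False
      hence "nested_tree B (g B)" using g [OF B] by (simp add: branches_def)
      hence "B \<in> S" using nested_treeD(1) B by (auto simp: S_def)
      moreover have False if W': "W' \<in> S" "B \<subset> W'" "W' \<subset> L" for W'
      proof -
        obtain B' where B': "B' \<in> \<pi>" "W' \<in> g B'" using W' unfolding S_def by blast
        have "B' = B" using unique [OF B'(1) B B'(2)] ne(1) [OF B] that(2) by auto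
        thus False using gD(2) [OF B'] that(2) by auto
      qed
      ultimately show ?thesis using strict [OF B] unfolding entering_edges_def by blast
    qed
  qed
  thus "entering_edges S L = \<pi>"
    using partition_on_subset_eq part partition_root_edges(1) [OF nested] by metis
qed

text \<open>Trees correspond to a root partition with a branch chosen over each block. The weight is
  multiplicative over vertices, so summing over the choices gives a product of sums.\<close>

lemma sum_tree_weight_root:
  fixes w :: "nat \<Rightarrow> 'r::comm_semiring_1" and L :: "'a set"
  assumes fin: "finite L"
  shows "(\<Sum>S | nested_tree L S. tree_weight w S) =
    (\<Sum>\<pi> | partition_on L \<pi> \<and> card \<pi> \<ge> 2. w (card \<pi>) * (\<Prod>B\<in>\<pi>. \<Sum>N\<in>branches B. tree_weight w N))"
proof -
  define P where "P = {\<pi>. partition_on L \<pi> \<and> card \<pi> \<ge> 2}"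
  have finP: "finite P" unfolding P_def
    using finitely_many_partition_on [OF fin] by (rule rev_finite_subset) auto
  have finpi: "finite \<pi>" if "\<pi> \<in> P" for \<pi>
    using that finite_elements [OF fin] by (simp add: P_def)
  have "(\<Sum>\<pi>\<in>P. w (card \<pi>) * (\<Prod>B\<in>\<pi>. \<Sum>N\<in>branches B. tree_weight w N)) =
      (\<Sum>\<pi>\<in>P. \<Sum>g\<in>PiE \<pi> branches. w (card \<pi>) * (\<Prod>B\<in>\<pi>. tree_weight w (g B)))"
    using finpi finite_branches by (intro sum.cong refl) (subst prod_sum_PiE, auto simp: sum_distrib_left)
  also have "\<dots> = (\<Sum>(\<pi>, g)\<in>(SIGMA \<pi>:P. PiE \<pi> branches). w (card \<pi>) * (\<Prod>B\<in>\<pi>. tree_weight w (g B)))"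
    using finP finpi finite_branches by (intro sum.Sigma) (auto intro!: finite_PiE)
  also have "\<dots> = (\<Sum>S | nested_tree L S. tree_weight w S)"
  proof (rule sum.reindex_bij_witness
      [of _ "\<lambda>S. (entering_edges S L, \<lambda>B\<in>entering_edges S L. {V \<in> S. V \<subseteq> B})"
          "\<lambda>(\<pi>, g). insert L (\<Union>B\<in>\<pi>. g B)"])
    fix x assume "x \<in> (SIGMA \<pi>:P. PiE \<pi> branches)"
    then obtain \<pi> g where x: "x = (\<pi>, g)" "partition_on L \<pi>" "card \<pi> \<ge> 2" "g \<in> PiE \<pi> branches"
      by (auto simp: P_def)
    have gB: "\<forall>B\<in>\<pi>. g B \<in> branches B" using x(4) by auto
    define S where "S = insert L (\<Union>B\<in>\<pi>. g B)"
    note G = graft_branches [OF fin x(2,3) gB, folded S_def]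
    have S: "(case x of (\<pi>, g) \<Rightarrow> insert L (\<Union>B\<in>\<pi>. g B)) = S" by (simp add: x(1) S_def)
    have "(\<lambda>B\<in>\<pi>. {V \<in> S. V \<subseteq> B}) = g"
      using G(3) x(4) by (intro ext) (auto simp: PiE_def extensional_def restrict_def)
    thus "(\<lambda>S. (entering_edges S L, \<lambda>B\<in>entering_edges S L. {V \<in> S. V \<subseteq> B}))
        (case x of (\<pi>, g) \<Rightarrow> insert L (\<Union>B\<in>\<pi>. g B)) = x"
      unfolding S using G(2) x(1) by simp
    show "(case x of (\<pi>, g) \<Rightarrow> insert L (\<Union>B\<in>\<pi>. g B)) \<in> {S. nested_tree L S}"
      unfolding S using G(1) by simp
    have fing: "finite (g B)" if "B \<in> \<pi>" for B
      using nested_treeD(3) [OF G(1)] that by (rule_tac finite_subset [of _ S]) (auto simp: S_def)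
    have "finite \<pi>" using finite_elements [OF fin x(2)] .
    \<comment> \<open>A vertex has the same entering edges in the whole tree as in its branch, so
      the weight factors over the branches.\<close>
    have edges: "entering_edges S V = entering_edges (g B) V" if "B \<in> \<pi>" "V \<in> g B" for B V
    proof -
      have "V \<in> S" "V \<subseteq> B" using G(3) [OF that(1)] that(2) by auto
      from entering_edges_restrict [OF G(1) this] show ?thesis using G(3) [OF that(1)] by simp
    qed
    have "tree_weight w S = w (card \<pi>) * (\<Prod>V\<in>(\<Union>B\<in>\<pi>. g B). w (card (entering_edges S V)))"
      unfolding tree_weight_def using G(2,4) \<open>finite \<pi>\<close> fing
      by (subst (1) S_def) (simp add: prod.insert)
    also have "(\<Prod>V\<in>(\<Union>B\<in>\<pi>. g B). w (card (entering_edges S V))) =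
        (\<Prod>B\<in>\<pi>. \<Prod>V\<in>g B. w (card (entering_edges S V)))"
      using G(5) \<open>finite \<pi>\<close> fing by (intro prod.UNION_disjoint) auto
    also have "\<dots> = (\<Prod>B\<in>\<pi>. tree_weight w (g B))"
      unfolding tree_weight_def using edges by (intro prod.cong refl) auto
    finally show "tree_weight w (case x of (\<pi>, g) \<Rightarrow> insert L (\<Union>B\<in>\<pi>. g B)) =
        (case x of (\<pi>, g) \<Rightarrow> w (card \<pi>) * (\<Prod>B\<in>\<pi>. tree_weight w (g B)))"
      unfolding S by (simp add: x(1))
  next
    fix S assume "S \<in> {S. nested_tree L S}"
    hence S: "nested_tree L S" by simp
    show "(entering_edges S L, \<lambda>B\<in>entering_edges S L. {V \<in> S. V \<subseteq> B}) \<in> (SIGMA \<pi>:P. PiE \<pi> branches)"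
      using partition_root_edges [OF S] root_branches(1) [OF S] by (simp add: P_def)
    show "(case (entering_edges S L, \<lambda>B\<in>entering_edges S L. {V \<in> S. V \<subseteq> B}) of
        (\<pi>, g) \<Rightarrow> insert L (\<Union>B\<in>\<pi>. g B)) = S"
      using root_branches(2) [OF S] by simp
  qed
  finally show ?thesis unfolding P_def by simp
qed

section \<open>The functional equation for weighted trees\<close>

text \<open>A branch is a single leaf, the term \<open>fps_X\<close>, or a root with
  \<open>n \<ge> 2\<close> branches above it; the latter contribute the coefficient of
  \<open>W\<close> at \<open>n\<close> times \<open>T ^ n\<close>.\<close>

lemma sum_tree_weight_branches:
  fixes T W :: "'r::{comm_ring_1,semiring_char_0} fps" and w :: "nat \<Rightarrow> 'r"
  assumes T: "fps_nth T 0 = 0" "T = fps_X + (W oo T)"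
    and W: "fps_nth W 0 = 0" "fps_nth W 1 = 0" "\<And>n. n \<ge> 2 \<Longrightarrow> w n = fact n * fps_nth W n"
    and L: "finite L" "L \<noteq> {}"
  shows "(\<Sum>N\<in>branches L. tree_weight w N) = fact (card L) * fps_nth T (card L)"
  using L
proof (induction "card L" arbitrary: L rule: less_induct)
  case less
  have TL: "fps_nth T n = (if n = 1 then 1 else 0) + (\<Sum>i=0..n. fps_nth W i * fps_nth (T ^ i) n)" for n
    by (subst T(2)) (simp add: fps_compose_nth)
  show ?case
  proof (cases "card L = 1")
    case True
    thus ?thesis using TL [of 1] W(1,2) by (simp add: branches_def tree_weight_def)
  next
    case False
    have fin: "finite L" by fact
    define f where "f B = (\<Sum>N\<in>branches B. tree_weight w N)" for B :: "'a set"
    \<comment> \<open>\<open>fps_power_partition_sum\<close> requires the closed form on every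
      nonempty subset, including \<open>L\<close> itself, where it is still to be proved. So
      \<open>f\<close> is replaced by its predicted value \<open>f'\<close>; they agree on the
      proper blocks by induction.\<close>
    define f' where "f' B = (fact (card B) * fps_nth T (card B) :: 'r)" for B :: "'a set"
    define P where "P n = {\<pi>. partition_on L \<pi> \<and> card \<pi> = n}" for n
    have le: "card \<pi> \<le> card L" if "partition_on L \<pi>" for \<pi>
    proof -
      \<comment> \<open>Choosing a point in each block embeds the partition into
        \<open>L\<close>.\<close>
      have "\<forall>B\<in>\<pi>. \<exists>x. x \<in> B" using partition_onD3 [OF that] by (metis all_not_in_conv)
      then obtain h where h: "\<And>B. B \<in> \<pi> \<Longrightarrow> h B \<in> B" by (metis bchoice)
      have "inj_on h \<pi>"
        using \<open>partition_on L \<pi>\<close> h by (intro inj_onI) (metis disjoint_iff disjointD partition_onD2)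
      moreover have "h ` \<pi> \<subseteq> L" using h \<open>partition_on L \<pi>\<close> by (auto simp: partition_on_def)
      ultimately show ?thesis using fin card_inj_on_le by blast
    qed
    have f: "f B = f' B" if B: "B \<in> \<pi>" "partition_on L \<pi>" "card \<pi> \<ge> 2" for B \<pi>
    proof -
      have "\<pi> \<noteq> {B}" using B(3) by auto
      then obtain B' where B': "B' \<in> \<pi>" "B' \<noteq> B" using B by auto
      moreover have "B' \<noteq> {}" "B \<noteq> {}" "B \<subseteq> L" "B' \<subseteq> L" "B \<inter> B' = {}"
        using B B' by (auto simp: partition_on_def disjoint_def)
      ultimately have "B \<subset> L" "B \<noteq> {}" by blast+
      thus ?thesis unfolding f_def f'_def using fin less.prems
        by (intro less.hyps) (auto intro: psubset_card_mono finite_subset)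
    qed
    have "(\<Sum>N\<in>branches L. tree_weight w N) = (\<Sum>N | nested_tree L N. tree_weight w N)"
      using False by (simp add: branches_def)
    also have "\<dots> = (\<Sum>\<pi> | partition_on L \<pi> \<and> card \<pi> \<ge> 2. w (card \<pi>) * (\<Prod>B\<in>\<pi>. f B))"
      unfolding f_def by (rule sum_tree_weight_root [OF fin])
    also have "\<dots> = (\<Sum>\<pi> | partition_on L \<pi> \<and> card \<pi> \<ge> 2. w (card \<pi>) * (\<Prod>B\<in>\<pi>. f' B))"
    proof (intro sum.cong refl)
      fix \<pi> assume "\<pi> \<in> {\<pi>. partition_on L \<pi> \<and> card \<pi> \<ge> 2}"
      hence "(\<Prod>B\<in>\<pi>. f B) = (\<Prod>B\<in>\<pi>. f' B)" using f by (intro prod.cong refl) auto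
      thus "w (card \<pi>) * (\<Prod>B\<in>\<pi>. f B) = w (card \<pi>) * (\<Prod>B\<in>\<pi>. f' B)" by simp
    qed
    also have "\<dots> = (\<Sum>n\<in>{2..card L}. \<Sum>\<pi>\<in>{\<pi>\<in>{\<pi>. partition_on L \<pi> \<and> card \<pi> \<ge> 2}. card \<pi> = n}. w (card \<pi>) * (\<Prod>B\<in>\<pi>. f' B))"
    proof (rule sum.group [symmetric])
      show "finite {\<pi>. partition_on L \<pi> \<and> card \<pi> \<ge> 2}"
        using finitely_many_partition_on [OF fin] by (rule rev_finite_subset) auto
    qed (use le in auto)
    also have "\<dots> = (\<Sum>n\<in>{2..card L}. fps_nth W n * (fact n * (\<Sum>\<pi>\<in>P n. \<Prod>B\<in>\<pi>. f' B)))"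
    proof (intro sum.cong refl)
      fix n assume n: "n \<in> {2..card L}"
      have "{\<pi>\<in>{\<pi>. partition_on L \<pi> \<and> card \<pi> \<ge> 2}. card \<pi> = n} = P n" using n by (auto simp: P_def)
      hence "(\<Sum>\<pi>\<in>{\<pi>\<in>{\<pi>. partition_on L \<pi> \<and> card \<pi> \<ge> 2}. card \<pi> = n}. w (card \<pi>) * (\<Prod>B\<in>\<pi>. f' B)) =
          (\<Sum>\<pi>\<in>P n. w n * (\<Prod>B\<in>\<pi>. f' B))"
        by (intro sum.cong) (auto simp: P_def)
      also have "\<dots> = fps_nth W n * (fact n * (\<Sum>\<pi>\<in>P n. \<Prod>B\<in>\<pi>. f' B))"
        using W(3) [of n] n by (simp add: sum_distrib_left mult_ac)
      finally show "(\<Sum>\<pi>\<in>{\<pi>\<in>{\<pi>. partition_on L \<pi> \<and> card \<pi> \<ge> 2}. card \<pi> = n}. w (card \<pi>) * (\<Prod>B\<in>\<pi>. f' B)) =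
        fps_nth W n * (fact n * (\<Sum>\<pi>\<in>P n. \<Prod>B\<in>\<pi>. f' B))" .
    qed
    also have "\<dots> = (\<Sum>n\<in>{2..card L}. fps_nth W n * (fact (card L) * fps_nth (T ^ n) (card L)))"
    proof -
      have "fact n * (\<Sum>\<pi>\<in>P n. \<Prod>B\<in>\<pi>. f' B) = fact (card L) * fps_nth (T ^ n) (card L)" for n
        unfolding P_def by (rule fps_power_partition_sum [OF fin T(1)]) (simp add: f'_def)
      thus ?thesis by simp
    qed
    also have "\<dots> = fact (card L) * (\<Sum>n\<in>{2..card L}. fps_nth W n * fps_nth (T ^ n) (card L))"
      by (simp add: sum_distrib_left mult_ac)
    \<comment> \<open>The terms for \<open>n = 0\<close> and \<open>n = 1\<close> vanish, so the sum
      is a coefficient of \<open>W oo T\<close>.\<close>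
    also have "(\<Sum>n\<in>{2..card L}. fps_nth W n * fps_nth (T ^ n) (card L)) =
        (\<Sum>n=0..card L. fps_nth W n * fps_nth (T ^ n) (card L))"
    proof (rule sum.mono_neutral_left)
      show "\<forall>n\<in>{0..card L} - {2..card L}. fps_nth W n * fps_nth (T ^ n) (card L) = 0"
      proof
        fix n assume "n \<in> {0..card L} - {2..card L}"
        hence "n = 0 \<or> n = 1" by auto
        thus "fps_nth W n * fps_nth (T ^ n) (card L) = 0" using W(1,2) by auto
      qed
    qed auto
    also have "\<dots> = fps_nth T (card L)" using TL [of "card L"] False by simp
    finally show ?thesis .
  qed
qed

section \<open>The cell count\<close>

lemma quad_coeff_1 [simp]: "quad_coeff r (Suc 0) = 1"
  by (simp add: quad_coeff.simps(2))

section \<open>Algebra of the two substitutions\<close>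

text \<open>\<open>T\<close> arises by solving the tree equation T = x + \<tau> (Y - T) for
  \<open>T\<close>. The first conclusion then says that \<open>Y\<close> is the quadratic series
  with parameter \<tau> evaluated at \<open>T\<close>; it is checked after multiplication by 1 +
  \<tau>.\<close>

lemma quadratic_shift_inner:
  fixes \<tau> v T x Y :: "'a::comm_ring_1"
  assumes v: "(1 + \<tau>) * v = 1" and T: "T = v * (x + \<tau> * Y)"
    and Y: "Y = x * (1 + Y) + (2 * \<tau> + \<tau> ^ 2) * Y ^ 2"
  shows "Y = T * (1 + Y) + \<tau> * Y ^ 2" "T = x + \<tau> * (Y - T)"
proof -
  have uT: "(1 + \<tau>) * T = x + \<tau> * Y" using v unfolding T by (simp add: mult.assoc [symmetric])
  have "(1 + \<tau>) * (T * (1 + Y) + \<tau> * Y ^ 2) = ((1 + \<tau>) * T) * (1 + Y) + (\<tau> + \<tau> ^ 2) * Y ^ 2"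
    by (simp add: algebra_simps power2_eq_square)
  also have "\<dots> = (x * (1 + Y) + (2 * \<tau> + \<tau> ^ 2) * Y ^ 2) + \<tau> * Y"
    unfolding uT by (simp add: algebra_simps power2_eq_square)
  also have "\<dots> = (1 + \<tau>) * Y" using Y by (simp add: algebra_simps)
  finally have "v * ((1 + \<tau>) * (T * (1 + Y) + \<tau> * Y ^ 2)) = v * ((1 + \<tau>) * Y)" by simp
  thus "Y = T * (1 + Y) + \<tau> * Y ^ 2" using v by (simp add: mult.assoc [symmetric] mult.commute [of v])
  show "T = x + \<tau> * (Y - T)" using uT by (simp add: algebra_simps)
qed

text \<open>The same for the outer trees: T = x + (Z - T) / (1 + \<tau>) is solved for
  \<open>T\<close>, which creates the denominator 2 + \<tau>, and the parameter 1 + 3 \<tau> +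
  \<tau>^2 drops to 2 \<tau> + \<tau>^2.\<close>

lemma quadratic_shift_outer:
  fixes \<tau> v v' T x Z :: "'a::comm_ring_1"
  assumes v: "(1 + \<tau>) * v = 1" and v': "(2 + \<tau>) * v' = 1" and T: "T = x + v' * (Z - x)"
    and Z: "Z = x * (1 + Z) + (1 + 3 * \<tau> + \<tau> ^ 2) * Z ^ 2"
  shows "Z = T * (1 + Z) + (2 * \<tau> + \<tau> ^ 2) * Z ^ 2" "T = x + v * (Z - T)"
proof -
  have uT: "(2 + \<tau>) * T = (1 + \<tau>) * x + Z"
  proof -
    have "(2 + \<tau>) * T = (2 + \<tau>) * x + ((2 + \<tau>) * v') * (Z - x)"
      unfolding T by (simp add: algebra_simps)
    thus ?thesis unfolding v' by (simp add: algebra_simps)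
  qed
  have "(2 + \<tau>) * (T * (1 + Z) + (2 * \<tau> + \<tau> ^ 2) * Z ^ 2) =
      ((2 + \<tau>) * T) * (1 + Z) + (2 + \<tau>) * (2 * \<tau> + \<tau> ^ 2) * Z ^ 2"
    by (simp add: algebra_simps)
  also have "\<dots> = (1 + \<tau>) * (x * (1 + Z) + (1 + 3 * \<tau> + \<tau> ^ 2) * Z ^ 2) + Z"
    unfolding uT by (simp add: algebra_simps power2_eq_square)
  also have "\<dots> = (2 + \<tau>) * Z" using Z by (simp add: algebra_simps)
  finally have "v' * ((2 + \<tau>) * (T * (1 + Z) + (2 * \<tau> + \<tau> ^ 2) * Z ^ 2)) = v' * ((2 + \<tau>) * Z)" by simp
  thus "Z = T * (1 + Z) + (2 * \<tau> + \<tau> ^ 2) * Z ^ 2"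
    using v' by (simp add: mult.assoc [symmetric] mult.commute [of v'])
  have "Z - T = (2 + \<tau>) * T - (1 + \<tau>) * x - T" unfolding uT by simp
  also have "\<dots> = (1 + \<tau>) * (T - x)" by (simp add: algebra_simps)
  finally have "v * (Z - T) = v * ((1 + \<tau>) * (T - x))" by simp
  also have "\<dots> = T - x" using v by (simp add: mult.assoc [symmetric] mult.commute [of v])
  finally show "T = x + v * (Z - T)" by simp
qed

section \<open>The inner layer: decorations of a single vertex\<close>

abbreviation (input) tt :: "rat fps" where "tt \<equiv> fps_X"

text \<open>The total weight of the decorations of a vertex with \<open>n\<close> entering edges, as
  \<open>sum_decorated_nested_trees\<close> shows. It is 0 for \<open>n < 2\<close>, where no nested
  tree exists.\<close>

definition decorated_weight :: "nat \<Rightarrow> rat fps" where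
  "decorated_weight n = (if n \<ge> 2 then fact n * (inverse (1 + tt) * quad_coeff (2 * tt + tt ^ 2) n) else 0)"

lemma inverse_1_plus_t: "(1 + tt) * inverse (1 + tt) = 1"
  by (simp add: inverse_mult_eq_1')

lemma inverse_2_plus_t: "(2 + tt) * inverse (2 + tt) = 1"
  by (simp add: inverse_mult_eq_1')

text \<open>The exponent \<open>card N - 1\<close> is one short of a factor \<open>tt\<close> per
  vertex. After multiplication by \<open>tt\<close> the sum is an ordinary tree weight, and
  \<open>tt\<close> is cancelled at the end.\<close>

lemma sum_decorated_nested_trees:
  assumes "finite L"
  shows "(\<Sum>N | nested_tree L N. tt ^ (card N - 1) *
      (\<Prod>U\<in>N. \<Sum>w\<in>cacti_cells (card (entering_edges N U)). tt ^ cacti_dim w)) = decorated_weight (card L)"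
    (is "?lhs = _")
proof (cases "card L \<ge> 2")
  case False
  hence "{N. nested_tree L N} = {}" using nested_treeD(4) by blast
  thus ?thesis using False by (simp add: decorated_weight_def)
next
  case True
  define c where "c n = (\<Sum>w\<in>cacti_cells n. tt ^ cacti_dim w)" for n
  define \<tau> where "\<tau> = fps_const tt"
  define v where "v = fps_const (inverse (1 + tt))"
  define Y where "Y = quad_series (2 * tt + tt ^ 2)"
  define T where "T = v * (fps_X + \<tau> * Y)"
  \<comment> \<open>Series of the vertex weights \<open>tt * c n\<close>; subtracting
    \<open>fps_X\<close> removes the linear coefficient, since vertices have at least two entering
    edges.\<close>
  define W where "W = \<tau> * (quad_series tt - fps_X)"
  have v: "(1 + \<tau>) * v = 1"
    using arg_cong [OF inverse_1_plus_t, of fps_const] unfolding \<tau>_def v_def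
    by (simp only: fps_const_mult [symmetric] fps_const_add [symmetric] fps_const_1_eq_1)
  have c\<tau>: "fps_const (2 * tt + tt ^ 2) = 2 * \<tau> + \<tau> ^ 2"
    by (simp add: \<tau>_def numeral_fps_const fps_const_power)
  have Yeq: "Y = fps_X * (1 + Y) + (2 * \<tau> + \<tau> ^ 2) * Y ^ 2"
    unfolding c\<tau> [symmetric] Y_def by (rule quad_series_eq)
  note shift = quadratic_shift_inner [OF v T_def Yeq]
  have T0: "fps_nth T 0 = 0" by (simp add: T_def Y_def)
  have comp: "quad_series tt oo T = Y"
    using shift(1) T0 by (intro quad_series_compose_unique) (simp_all add: \<tau>_def Y_def)
  have "W oo T = \<tau> * (Y - T)"
    unfolding W_def using T0 comp
    by (simp add: fps_compose_mult_distrib fps_compose_sub_distrib \<tau>_def)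
  hence TW: "T = fps_X + (W oo T)" using shift(2) by simp
  have "tt * ?lhs = (\<Sum>N | nested_tree L N. tree_weight (\<lambda>n. tt * c n) N)"
    unfolding sum_distrib_left
  proof (intro sum.cong refl)
    fix N assume "N \<in> {N. nested_tree L N}"
    hence N: "nested_tree L N" by simp
    have "card N \<ge> 1" using nested_treeD(1,3) [OF N] by (auto simp: Suc_le_eq card_gt_0_iff)
    hence "tt * tt ^ (card N - 1) = tt ^ card N" by (cases "card N") auto
    thus "tt * (tt ^ (card N - 1) *
        (\<Prod>U\<in>N. \<Sum>w\<in>cacti_cells (card (entering_edges N U)). tt ^ cacti_dim w)) = tree_weight (\<lambda>n. tt * c n) N"
      by (simp add: tree_weight_def prod.distrib c_def mult.assoc [symmetric])
  qed
  also have "\<dots> = (\<Sum>N\<in>branches L. tree_weight (\<lambda>n. tt * c n) N)"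
    using True by (simp add: branches_def)
  also have "\<dots> = fact (card L) * fps_nth T (card L)"
  proof (rule sum_tree_weight_branches [OF T0 TW])
    show "tt * c n = fact n * fps_nth W n" if "n \<ge> 2" for n
      using that by (simp add: c_def sum_cacti_cells W_def \<tau>_def)
  qed (use True assms in \<open>auto simp: W_def \<tau>_def\<close>)
  also have "\<dots> = tt * decorated_weight (card L)"
    using True by (simp add: T_def v_def \<tau>_def Y_def decorated_weight_def)
  finally show ?thesis by simp
qed

section \<open>The outer layer: cells of the Fulton-MacPherson spaces\<close>

lemma FM_cells_Sigma:
  "FM_cells k = (SIGMA S:{S. nested_tree {1..k} S}.
     SIGMA T:(\<Pi>\<^sub>E V\<in>S. {N. nested_tree (entering_edges S V) N}).
       (\<Pi>\<^sub>E V\<in>S. \<Pi>\<^sub>E U\<in>T V. cacti_cells (card (entering_edges (T V) U))))"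
  by (auto simp: FM_cells_def)

text \<open>The dimension is a sum over the vertices, so its power of \<open>tt\<close> is a
  product, and the decorations of different vertices are chosen independently.\<close>

lemma FM_cells_sum:
  "finite (FM_cells k)" 
  "(\<Sum>c\<in>FM_cells k. tt ^ FM_dim c) = (\<Sum>S | nested_tree {1..k} S. tree_weight decorated_weight S)"
proof -
  define A where "A = {S. nested_tree {1..k} S}"
  define B where "B S = (\<Pi>\<^sub>E V\<in>S. {N. nested_tree (entering_edges S V) N})" for S :: "nat set set"
  define C where "C S T = (\<Pi>\<^sub>E V\<in>S. \<Pi>\<^sub>E U\<in>T V. cacti_cells (card (entering_edges (T V) U)))"
    for S :: "nat set set" and T :: "nat set \<Rightarrow> nat set set set"
  have FM: "FM_cells k = (SIGMA S:A. SIGMA T:B S. C S T)"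
    unfolding FM_cells_Sigma A_def B_def C_def ..
  have finA: "finite A" unfolding A_def by (rule finite_nested_trees)
  have finS: "finite S" if "S \<in> A" for S using that nested_treeD(3) by (auto simp: A_def)
  have finB: "finite (B S)" if "S \<in> A" for S
    unfolding B_def using finS [OF that] finite_nested_trees by (intro finite_PiE) auto
  have finT: "finite (T V)" if "S \<in> A" "T \<in> B S" "V \<in> S" for S T V
    using that nested_treeD(3) by (fastforce simp: B_def)
  have finC: "finite (C S T)" if "S \<in> A" "T \<in> B S" for S T
    unfolding C_def using finS [OF that(1)] finT [OF that] finite_cacti_cells
    by (intro finite_PiE) auto
  show "finite (FM_cells k)" unfolding FM using finA finB finC by (intro finite_SigmaI) auto
  have "(\<Sum>c\<in>FM_cells k. tt ^ FM_dim c) = (\<Sum>S\<in>A. \<Sum>T\<in>B S. \<Sum>\<sigma>\<in>C S T. tt ^ FM_dim (S, T, \<sigma>))"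
  proof -
    have "(\<Sum>T\<in>B S. \<Sum>\<sigma>\<in>C S T. tt ^ FM_dim (S, T, \<sigma>)) = (\<Sum>p\<in>Sigma (B S) (C S). tt ^ FM_dim (S, p))"
      if "S \<in> A" for S
      using finB [OF that] finC [OF that]
      by (subst sum.Sigma) (auto simp: case_prod_unfold simp del: FM_dim.simps)
    hence "(\<Sum>S\<in>A. \<Sum>T\<in>B S. \<Sum>\<sigma>\<in>C S T. tt ^ FM_dim (S, T, \<sigma>)) =
        (\<Sum>S\<in>A. \<Sum>p\<in>Sigma (B S) (C S). tt ^ FM_dim (S, p))"
      by (intro sum.cong refl)
    also have "\<dots> = (\<Sum>(S, p)\<in>(SIGMA S:A. Sigma (B S) (C S)). tt ^ FM_dim (S, p))"
      using finA finB finC by (intro sum.Sigma) auto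
    finally show ?thesis unfolding FM by (simp add: case_prod_unfold del: FM_dim.simps)
  qed
  also have "\<dots> = (\<Sum>S\<in>A. tree_weight decorated_weight S)"
  proof (intro sum.cong refl)
    fix S assume S: "S \<in> A"
    define h where "h N = tt ^ (card N - 1) *
      (\<Prod>U\<in>N. \<Sum>w\<in>cacti_cells (card (entering_edges N U)). tt ^ cacti_dim w)" for N :: "nat set set set"
    have "(\<Sum>T\<in>B S. \<Sum>\<sigma>\<in>C S T. tt ^ FM_dim (S, T, \<sigma>)) = (\<Sum>T\<in>B S. \<Prod>V\<in>S. h (T V))"
    proof (intro sum.cong refl)
      fix T assume T: "T \<in> B S"
      have "(\<Sum>\<sigma>\<in>C S T. tt ^ FM_dim (S, T, \<sigma>)) =
          (\<Sum>\<sigma>\<in>C S T. \<Prod>V\<in>S. tt ^ (card (T V) - 1) * (\<Prod>U\<in>T V. tt ^ cacti_dim (\<sigma> V U)))"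
        by (simp add: power_sum power_add)
      \<comment> \<open>A sum over the family \<open>\<sigma>\<close> becomes a product of sums over
        the single \<open>\<sigma> V\<close>. The same exchange is repeated inside each
        \<open>V\<close>, and then for the choice of \<open>T\<close>.\<close>
      also have "\<dots> = (\<Prod>V\<in>S. \<Sum>s\<in>(\<Pi>\<^sub>E U\<in>T V. cacti_cells (card (entering_edges (T V) U))).
          tt ^ (card (T V) - 1) * (\<Prod>U\<in>T V. tt ^ cacti_dim (s U)))"
        unfolding C_def using finS [OF S] finT [OF S T] finite_cacti_cells
        by (intro prod_sum_PiE [symmetric]) (auto intro!: finite_PiE)
      also have "\<dots> = (\<Prod>V\<in>S. h (T V))"
      proof (intro prod.cong refl)
        fix V assume V: "V \<in> S"
        show "(\<Sum>s\<in>(\<Pi>\<^sub>E U\<in>T V. cacti_cells (card (entering_edges (T V) U))).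
            tt ^ (card (T V) - 1) * (\<Prod>U\<in>T V. tt ^ cacti_dim (s U))) = h (T V)"
          unfolding h_def sum_distrib_left [symmetric] using finT [OF S T V] finite_cacti_cells
          by (subst prod_sum_PiE) auto
      qed
      finally show "(\<Sum>\<sigma>\<in>C S T. tt ^ FM_dim (S, T, \<sigma>)) = (\<Prod>V\<in>S. h (T V))" .
    qed
    also have "\<dots> = (\<Prod>V\<in>S. \<Sum>N | nested_tree (entering_edges S V) N. h N)"
      unfolding B_def using finS [OF S] finite_nested_trees by (intro prod_sum_PiE [symmetric]) auto
    also have "\<dots> = tree_weight decorated_weight S"
      unfolding tree_weight_def h_def using S finite_entering_edges
      by (intro prod.cong refl sum_decorated_nested_trees) (auto simp: A_def)
    finally show "(\<Sum>T\<in>B S. \<Sum>\<sigma>\<in>C S T. tt ^ FM_dim (S, T, \<sigma>)) = tree_weight decorated_weight S" .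
  qed
  finally show "(\<Sum>c\<in>FM_cells k. tt ^ FM_dim c) = (\<Sum>S | nested_tree {1..k} S. tree_weight decorated_weight S)"
    by (simp add: A_def)
qed

text \<open>The tree equation is applied a second time, now with the decorated weights as vertex
  weights; \<open>quadratic_shift_outer\<close> provides its solution.\<close>

lemma FM_cells_sum_eq:
  assumes "k > 1"
  shows "(\<Sum>c\<in>FM_cells k. tt ^ FM_dim c) =
    fact k * (inverse (2 + tt) * quad_coeff (1 + 3 * tt + tt ^ 2) k)"
proof -
  define \<tau> where "\<tau> = fps_const tt"
  define v where "v = fps_const (inverse (1 + tt))"
  define v' where "v' = fps_const (inverse (2 + tt))"
  define Z where "Z = quad_series (1 + 3 * tt + tt ^ 2)"
  define T where "T = fps_X + v' * (Z - fps_X)"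
  define W where "W = v * (quad_series (2 * tt + tt ^ 2) - fps_X)"
  have v: "(1 + \<tau>) * v = 1"
    using arg_cong [OF inverse_1_plus_t, of fps_const] unfolding \<tau>_def v_def
    by (simp only: fps_const_mult [symmetric] fps_const_add [symmetric] fps_const_1_eq_1)
  have v': "(2 + \<tau>) * v' = 1"
    using arg_cong [OF inverse_2_plus_t, of fps_const] unfolding \<tau>_def v'_def
    by (simp only: fps_const_mult [symmetric] fps_const_add [symmetric] fps_const_1_eq_1 numeral_fps_const)
  have c\<tau>: "fps_const (2 * tt + tt ^ 2) = 2 * \<tau> + \<tau> ^ 2"
    by (simp add: \<tau>_def numeral_fps_const fps_const_power)
  have c\<tau>': "fps_const (1 + 3 * tt + tt ^ 2) = 1 + 3 * \<tau> + \<tau> ^ 2"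
    by (simp add: \<tau>_def numeral_fps_const fps_const_power flip: fps_const_1_eq_1)
  have Zeq: "Z = fps_X * (1 + Z) + (1 + 3 * \<tau> + \<tau> ^ 2) * Z ^ 2"
    unfolding c\<tau>' [symmetric] Z_def by (rule quad_series_eq)
  note shift = quadratic_shift_outer [OF v v' T_def Zeq]
  have T0: "fps_nth T 0 = 0" by (simp add: T_def Z_def)
  have comp: "quad_series (2 * tt + tt ^ 2) oo T = Z"
    using shift(1) T0 unfolding c\<tau> [symmetric]
    by (intro quad_series_compose_unique) (simp_all add: Z_def)
  have "W oo T = v * (Z - T)"
    unfolding W_def using T0 comp
    by (simp add: fps_compose_mult_distrib fps_compose_sub_distrib v_def)
  hence TW: "T = fps_X + (W oo T)" using shift(2) by simp
  have "(\<Sum>S | nested_tree {1..k} S. tree_weight decorated_weight S) =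
      (\<Sum>S\<in>branches {1..k}. tree_weight decorated_weight S)"
    using assms by (simp add: branches_def)
  also have "\<dots> = fact (card {1..k}) * fps_nth T (card {1..k})"
  proof (rule sum_tree_weight_branches [OF T0 TW])
    show "decorated_weight n = fact n * fps_nth W n" if "n \<ge> 2" for n
      using that by (simp add: decorated_weight_def W_def v_def)
  qed (use assms in \<open>auto simp: W_def v_def\<close>)
  finally show ?thesis
    unfolding FM_cells_sum(2) using assms by (simp add: T_def v'_def Z_def)
qed

lemma FM_series_eq:
  "FM_series = fps_const (inverse (2 + tt)) * (quad_series (1 + 3 * tt + tt ^ 2) - ser_x)"
proof (rule fps_ext)
  fix k
  show "fps_nth FM_series k =
    fps_nth (fps_const (inverse (2 + tt)) * (quad_series (1 + 3 * tt + tt ^ 2) - ser_x)) k"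
  proof (cases "k > 1")
    case False
    \<comment> \<open>\<open>FM_series\<close> starts in degree 2. The quadratic series has no
      constant term, and its linear coefficient 1 is cancelled by \<open>ser_x\<close>.\<close>
    hence "k = 0 \<or> k = 1" by auto
    thus ?thesis by (auto simp: FM_series_def fps_zero_def)
  next
    case True
    define a where "a = inverse (2 + tt) * quad_coeff (1 + 3 * tt + tt ^ 2) k"
    have fact: "(fact k :: rat fps) = fps_const (fact k)"
      by (metis fps_of_nat of_nat_fact)
    have "of_nat (FM_face_number k m) = fact k * fps_nth a m" for m
    proof -
      \<comment> \<open>The coefficient of \<open>tt ^ m\<close> in the weight sum picks out the
        cells of dimension \<open>m\<close>.\<close>
      have "of_nat (FM_face_number k m) = (\<Sum>c\<in>FM_cells k. if FM_dim c = m then 1 else 0 :: rat)"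
        using FM_cells_sum(1) [of k] by (simp add: FM_face_number_def sum.If_cases Int_def)
      also have "\<dots> = fps_nth (\<Sum>c\<in>FM_cells k. tt ^ FM_dim c) m"
        by (simp add: fps_sum_nth fps_X_power_nth eq_commute)
      also have "\<dots> = fact k * fps_nth a m"
        unfolding FM_cells_sum_eq [OF True] a_def [symmetric] fact by simp
      finally show ?thesis .
    qed
    hence "fps_nth FM_series k = a" using True by (simp add: FM_series_def fps_eq_iff)
    thus ?thesis using True by (simp add: a_def)
  qed
qed

section \<open>Algebraicity and the explicit formula\<close>

lemma series_of_bipoly_0 [simp]: "series_of_bipoly 0 = 0"
  by (simp add: series_of_bipoly_def)

lemma series_of_bipoly_pCons [simp]:
  "series_of_bipoly (pCons a p) = fps_const (fps_of_poly a) + series_of_bipoly p * ser_x"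
  by (simp add: series_of_bipoly_def map_poly_pCons fps_of_poly_pCons)

text \<open>The formula solves the quadratic equation for the series by radicals: \<open>R\<close>
  is the square root of the discriminant, and its constant term 1 fixes the sign.\<close>

theorem theorem6p20:
  "algebraic_series FM_series \<and>
   (let q = 1 + 3 * ser_t + ser_t ^ 2 in
    \<exists>R :: rat fps fps.
      R ^ 2 = (1 - ser_x) ^ 2 - 4 * q * ser_x \<and> fps_nth R 0 = 1 \<and>
      2 * q * (2 + ser_t) * FM_series = 1 - ser_x - 2 * q * ser_x - R)"
proof -
  define q where "q = 1 + 3 * ser_t + ser_t ^ 2"
  define Z where "Z = quad_series (1 + 3 * tt + tt ^ 2)"
  define D where "D = 2 + ser_t"
  have q: "fps_const (1 + 3 * tt + tt ^ 2) = q"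
    by (simp add: q_def numeral_fps_const fps_const_power flip: fps_const_1_eq_1)
  hence Z: "Z = ser_x * (1 + Z) + q * Z ^ 2"
    unfolding Z_def using quad_series_eq by metis
  have "D * fps_const (inverse (2 + tt)) = 1"
    using arg_cong [OF inverse_2_plus_t, of fps_const] unfolding D_def
    by (simp only: fps_const_mult [symmetric] fps_const_add [symmetric] fps_const_1_eq_1 numeral_fps_const)
  hence F: "D * FM_series = Z - ser_x"
    unfolding FM_series_eq Z_def by (simp add: mult.assoc [symmetric])
  \<comment> \<open>Read off from the quadratic formula 2 q Z = 1 - x - R, so the square root is
    obtained from \<open>Z\<close> instead of being constructed separately.\<close>
  define R where "R = 1 - ser_x - 2 * q * Z"
  have "R ^ 2 = (1 - ser_x) ^ 2 - 4 * q * ser_x + 4 * q * ((ser_x * (1 + Z) + q * Z ^ 2) - Z)"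
    by (simp add: R_def algebra_simps power2_eq_square)
  hence "R ^ 2 = (1 - ser_x) ^ 2 - 4 * q * ser_x" using Z by simp
  moreover have "fps_nth R 0 = 1" by (simp add: R_def Z_def)
  moreover have "2 * q * D * FM_series = 1 - ser_x - 2 * q * ser_x - R"
    using F by (simp add: R_def mult.assoc) (simp add: algebra_simps)
  moreover have "algebraic_series FM_series"
  proof -
    define d :: "rat poly" where "d = [:2, 1:]"
    define p :: "rat poly" where "p = [:1, 3, 1:]"
    \<comment> \<open>Coefficients, in powers of F, of x (1 + Z) + q Z^2 - Z after the substitution
      Z = D F + x; \<open>d\<close> and \<open>p\<close> are the polynomials behind \<open>D\<close>
      and \<open>q\<close>.\<close>
    define P where "P = [:[:0, 0, 1 + p:], [:- d, d + 2 * p * d:], [:p * d ^ 2:]:]"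
    have d: "fps_const (fps_of_poly d) = D"
      by (simp add: d_def D_def fps_of_poly_pCons numeral_fps_const)
    have p: "fps_const (fps_of_poly p) = q"
    proof -
      have "fps_of_poly p = 1 + 3 * tt + tt ^ 2"
        by (simp add: p_def fps_of_poly_pCons power2_eq_square algebra_simps flip: numeral_fps_const)
      thus ?thesis using q by (simp only:)
    qed
    note hom = fps_of_poly_add fps_of_poly_mult fps_of_poly_power fps_of_poly_uminus
      fps_const_add [symmetric] fps_const_mult [symmetric] fps_const_neg [symmetric] fps_const_power [symmetric]
    have "poly (map_poly series_of_bipoly P) FM_series =
        (1 + q) * ser_x ^ 2 + ((D + 2 * q * D) * ser_x - D) * FM_series + q * D ^ 2 * FM_series ^ 2"
      by (simp add: P_def map_poly_pCons) (simp only: hom d p, simp add: algebra_simps power2_eq_square)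
    also have "\<dots> = (ser_x * (1 + (D * FM_series + ser_x)) + q * (D * FM_series + ser_x) ^ 2) - (D * FM_series + ser_x)"
      by (simp add: algebra_simps power2_eq_square)
    also have "\<dots> = 0" unfolding F using Z by simp
    finally have "poly (map_poly series_of_bipoly P) FM_series = 0" .
    moreover have "P \<noteq> 0" by (simp add: P_def p_def d_def)
    ultimately show ?thesis unfolding algebraic_series_def by blast
  qed
  ultimately show ?thesis unfolding Let_def q_def D_def by blast
qed

end
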